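(* Let $U$ be a $5$-unitrade with $|U|=16$. Then $U$ is equivalent to exactly one of the following kinds of collections (up to equivalence): (1) $W\cup R$, where $W$ is a $5$-unitrade equivalent to $W_5$, $R$ is a $5$-unitrade equivalent to $R_5$, and $W\cap R=\emptyset$; (2) $E=\{\{1,2,3,5,6\}, \{1,2,4,5,6\}, \{1,3,4,5,6\}, \{2,3,4,5,6\}, \{1,2,3,5,7\}, \{1,2,4,5,7\}, \{1,3,4,5,7\}, \{2,3,4,5,7\}, \{1,2,3,6,7\}, \{1,2,4,6,7\}, \{1,3,4,6,7\}, \{2,3,4,6,8\},\{2,3,4,7,8\},\{2,3,6,7,8\},\{2,4,6,7,8\},\{3,4,6,7,8\}\}$; (3) $F=\{\{1,2,3,5,7\}, \{1,2,4,5,7\}, \{1,3,4,5,7\}, \{2,3,4,5,7\}, \{1,2,3,6,7\}, \{1,2,4,6,7\}, \{1,3,4,6,7\}, \{2,3,4,6,7\}, \{1,2,3,6,8\}, \{1,2,4,6,8\}, \{1,3,4,6,8\}, \{2,3,4,6,8\}, \{1,2,3,5,8\}, \{1,2,4,5,8\}, \{1,3,4,5,8\}, \{2,3,4,5,8\}\}$.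
   Context: Let $V$ be a finite set. A $k$-unitrade on $V$ is a set $U$ of $k$-element subsets (blocks) of $V$ such that every $(k-1)$-element subset of $V$ is contained in an even number of blocks of $U$. Two collections $U_1$ of subsets of a set $V_1$ and $U_2$ of subsets of a set $V_2$ are equivalent if there is an injection $f:V_1\to V_2$ with $U_2=\{f(u): u\in U_1\}$. $W_5$ denotes the set of all $5$-element subsets of $\{1,\dots,6\}$, and $R_5=\{\{2,3,4,5,6\},\{1,3,4,5,6\},\{1,2,4,5,6\},\{1,2,3,5,6\},\{1,2,3,4,6\},\{2,3,4,5,7\},\{1,3,4,5,7\},\{1,2,4,5,7\},\{1,2,3,5,7\},\{1,2,3,4,7\}\}$. *)

theory Defs
  imports Main
begin

definition unitrade_on :: "nat \<Rightarrow> 'a set \<Rightarrow> 'a set set \<Rightarrow> bool" where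
  "unitrade_on k V U \<longleftrightarrow>
     finite V \<and> (\<forall>B\<in>U. B \<subseteq> V \<and> card B = k) \<and>
     (\<forall>T. T \<subseteq> V \<and> card T = k - 1 \<longrightarrow> even (card {B\<in>U. T \<subseteq> B}))"

definition unitrade :: "nat \<Rightarrow> 'a set set \<Rightarrow> bool" where
  "unitrade k U \<longleftrightarrow> (\<exists>V. unitrade_on k V U)"

definition equivalent :: "'a set set \<Rightarrow> 'b set set \<Rightarrow> bool" where
  "equivalent U1 U2 \<longleftrightarrow> (\<exists>f. inj_on f (\<Union>U1) \<and> U2 = (\<lambda>u. f ` u) ` U1)"

definition W5 :: "nat set set" where
  "W5 = {S. S \<subseteq> {1..6} \<and> card S = 5}"

definition R5 :: "nat set set" where
  "R5 = {{2,3,4,5,6},{1,3,4,5,6},{1,2,4,5,6},{1,2,3,5,6},{1,2,3,4,6},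
         {2,3,4,5,7},{1,3,4,5,7},{1,2,4,5,7},{1,2,3,5,7},{1,2,3,4,7}}"

definition E16 :: "nat set set" where
  "E16 = {{1,2,3,5,6}, {1,2,4,5,6}, {1,3,4,5,6}, {2,3,4,5,6}, {1,2,3,5,7}, {1,2,4,5,7},
          {1,3,4,5,7}, {2,3,4,5,7}, {1,2,3,6,7}, {1,2,4,6,7}, {1,3,4,6,7}, {2,3,4,6,8},
          {2,3,4,7,8}, {2,3,6,7,8}, {2,4,6,7,8}, {3,4,6,7,8}}"

definition F16 :: "nat set set" where
  "F16 = {{1,2,3,5,7}, {1,2,4,5,7}, {1,3,4,5,7}, {2,3,4,5,7}, {1,2,3,6,7}, {1,2,4,6,7},
          {1,3,4,6,7}, {2,3,4,6,7}, {1,2,3,6,8}, {1,2,4,6,8}, {1,3,4,6,8}, {2,3,4,6,8},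
          {1,2,3,5,8}, {1,2,4,5,8}, {1,3,4,5,8}, {2,3,4,5,8}}"

definition kind_WR :: "'a set set \<Rightarrow> bool" where
  "kind_WR U \<longleftrightarrow> (\<exists>W R. U = W \<union> R \<and> W \<inter> R = {} \<and>
       unitrade 5 W \<and> unitrade 5 R \<and> equivalent W W5 \<and> equivalent R R5)"

end

theory Submission
  imports Defs
begin

text \<open>
  A unitrade is a mod-2 simplicial cycle. If the link of a vertex v is the boundary of a chain S
  that avoids v, then replacing the star of v by S produces a unitrade without v, whose size is
  controlled by the number of blocks of S that already belong to U. Double counting provides
  a vertex of small degree, whose link is a small unitrade of the next lower order; hence by
  induction on the order all 4-unitrades of size at most 10 and all 5-unitrades of size at most 12
  are boundaries of simplices, disjoint unions of two of these, or joins of two such boundaries.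
  In a 5-unitrade of size 16 some vertex has degree 5, 8, 9 or 10: otherwise all degrees are at
  least 11, so there are at most 7 points, and these carry unitrades of size at most 12 only.
  Each of the four degrees is treated by one replacement of a star.
\<close>

section \<open>Links and counting\<close>

text \<open>The obstacle is a filling \<open>S\<close> that meets \<open>U\<close> only partly: its
  common blocks cancel, and the smaller unitrade need neither split off from \<open>U\<close> nor
  let \<open>U\<close> be read back as a join. Arithmetic removes most of these cases. Surgery
  leaves |U| - |link| + |S| - 2t blocks, where t counts the common ones, and 5-unitrades with at
  most 12 blocks have sizes 0, 6, 10 and 12 only. The gaps at 4 and 8 leave few values of t, and
  each can be interpreted directly or yields a vertex of smaller degree. The bounds 10 and 12 are
  what size 16 demands: links with at most 10 blocks are inspected, and surgery there leaves at most
  12 blocks. Two invariants separate the kinds. The first kind contains the boundary of a simplex on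
  six points and the others do not; every block of \<open>F16\<close> meets \<open>{1,2,3,4}\<close>
  in three points, a pattern that the star of 8 in \<open>E16\<close> cannot follow.\<close>

lemma unitrade_iff:
  "unitrade k U \<longleftrightarrow> finite U \<and> (\<forall>B\<in>U. finite B \<and> card B = k) \<and>
     (\<forall>T. finite T \<and> card T = k - 1 \<longrightarrow> even (card {B\<in>U. T \<subseteq> B}))"
proof
  assume "unitrade k U"
  then obtain V where V: "finite V" "\<forall>B\<in>U. B \<subseteq> V \<and> card B = k"
    and ev: "\<forall>T. T \<subseteq> V \<and> card T = k - 1 \<longrightarrow> even (card {B\<in>U. T \<subseteq> B})"
    unfolding unitrade_def unitrade_on_def by blast
  have "U \<subseteq> Pow V" using V by blast
  then have "finite U" using V(1) by (meson finite_Pow_iff finite_subset)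
  moreover have "even (card {B\<in>U. T \<subseteq> B})" if "card T = k - 1" for T
  proof (cases "T \<subseteq> V")
    case False
    then have "{B\<in>U. T \<subseteq> B} = {}" using V(2) by blast
    then show ?thesis by (simp only: card.empty even_zero)
  qed (use ev that in blast)
  ultimately show "finite U \<and> (\<forall>B\<in>U. finite B \<and> card B = k) \<and>
     (\<forall>T. finite T \<and> card T = k - 1 \<longrightarrow> even (card {B\<in>U. T \<subseteq> B}))"
    using V by (meson finite_subset)
next
  assume *: "finite U \<and> (\<forall>B\<in>U. finite B \<and> card B = k) \<and>
     (\<forall>T. finite T \<and> card T = k - 1 \<longrightarrow> even (card {B\<in>U. T \<subseteq> B}))"
  then have "finite (\<Union>U)" by blast
  then have "unitrade_on k (\<Union>U) U"
    unfolding unitrade_on_def using * by (meson Sup_upper finite_subset)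
  then show "unitrade k U" unfolding unitrade_def by blast
qed

lemma unitrade_finite: "unitrade k U \<Longrightarrow> finite U"
  and unitrade_finite_block: "unitrade k U \<Longrightarrow> B \<in> U \<Longrightarrow> finite B"
  and unitrade_card_block: "unitrade k U \<Longrightarrow> B \<in> U \<Longrightarrow> card B = k"
  and unitrade_even: "unitrade k U \<Longrightarrow> finite T \<Longrightarrow> card T = k - 1 \<Longrightarrow> even (card {B\<in>U. T \<subseteq> B})"
  by (auto simp: unitrade_iff)

lemma unitrade_finite_Union: "unitrade k U \<Longrightarrow> finite (\<Union>U)"
  by (auto simp: unitrade_iff)

definition link :: "'a set set \<Rightarrow> 'a \<Rightarrow> 'a set set" where
  "link U v = {T. v \<notin> T \<and> insert v T \<in> U}"

lemma bij_betw_link: "bij_betw (insert v) (link U v) {B\<in>U. v \<in> B}"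
  by (rule bij_betw_byWitness[where f' = "\<lambda>B. B - {v}"]) (auto simp: link_def insert_absorb)

lemma card_link: "card (link U v) = card {B\<in>U. v \<in> B}"
  using bij_betw_link by (rule bij_betw_same_card)

lemma insert_link: "insert v ` link U v = {B\<in>U. v \<in> B}"
  using bij_betw_link by (rule bij_betw_imp_surj_on)

lemma card_eq_link_plus:
  assumes "finite U"
  shows "card U = card (link U v) + card {B\<in>U. v \<notin> B}"
proof -
  have "card U = card ({B\<in>U. v \<in> B} \<union> {B\<in>U. v \<notin> B})" by (rule arg_cong[where f = card]) auto
  also have "\<dots> = card {B\<in>U. v \<in> B} + card {B\<in>U. v \<notin> B}"
    by (rule card_Un_disjoint) (use assms in auto)
  finally show ?thesis by (simp add: card_link)
qed

text \<open>Adding \<open>v\<close> matches the blocks of the link over \<open>T\<close> with the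
  blocks of \<open>U\<close> over \<open>insert v T\<close>. Positivity of k matters for truncated
  subtraction: it makes \<open>insert v T\<close> a set of size k when
  \<open>card T = k - 1\<close>.\<close>

lemma unitrade_link:
  fixes U :: "'a set set"
  assumes U: "unitrade (Suc k) U" and k: "k > 0"
  shows "unitrade k (link U v)"
  unfolding unitrade_iff
proof (intro conjI ballI allI impI)
  have "finite {B\<in>U. v \<in> B}" using unitrade_finite[OF U] by auto
  then show "finite (link U v)" using bij_betw_finite[OF bij_betw_link[of v U]] by simp
next
  fix T assume T: "T \<in> link U v"
  then have T: "insert v T \<in> U" "v \<notin> T" by (auto simp: link_def)
  then have "finite (insert v T)" "card (insert v T) = Suc k"
    using unitrade_finite_block[OF U T(1)] unitrade_card_block[OF U T(1)] by auto
  then show "finite T" "card T = k" using T by auto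
next
  fix T :: "'a set" assume T: "finite T \<and> card T = k - 1"
  show "even (card {B \<in> link U v. T \<subseteq> B})"
  proof (cases "v \<in> T")
    case True
    then have "{B \<in> link U v. T \<subseteq> B} = {}" by (auto simp: link_def)
    then show ?thesis by (simp only: card.empty even_zero)
  next
    case False
    have "bij_betw (insert v) {B \<in> link U v. T \<subseteq> B} {B\<in>U. insert v T \<subseteq> B}"
      by (rule bij_betw_byWitness[where f' = "\<lambda>B. B - {v}"]) (use False in \<open>auto simp: link_def insert_absorb\<close>)
    then have "card {B \<in> link U v. T \<subseteq> B} = card {B\<in>U. insert v T \<subseteq> B}"
      by (rule bij_betw_same_card)
    moreover have "even (card {B\<in>U. insert v T \<subseteq> B})"
      by (rule unitrade_even[OF U]) (use False T k in auto)
    ultimately show ?thesis by simp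
  qed
qed

lemma sum_card_link:
  assumes U: "unitrade k U"
  shows "(\<Sum>v\<in>\<Union>U. card (link U v)) = k * card U"
proof -
  have "(\<Sum>v\<in>\<Union>U. card (link U v)) = (\<Sum>v\<in>\<Union>U. \<Sum>B\<in>U. if v \<in> B then 1 else 0)"
    using unitrade_finite[OF U] by (simp add: card_link sum.If_cases Int_def)
  also have "\<dots> = (\<Sum>B\<in>U. \<Sum>v\<in>\<Union>U. if v \<in> B then 1 else 0)" by (rule sum.swap)
  also have "\<dots> = (\<Sum>B\<in>U. k)"
  proof (rule sum.cong)
    fix B assume B: "B \<in> U"
    then have "\<Union>U \<inter> {v. v \<in> B} = B" by auto
    then show "(\<Sum>v\<in>\<Union>U. if v \<in> B then 1 else 0) = k"
      using unitrade_finite_Union[OF U] unitrade_card_block[OF U B] by (simp add: sum.If_cases)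
  qed simp
  finally show ?thesis by simp
qed

lemma min_degree:
  assumes U: "unitrade k U" and m: "\<And>v. v \<in> \<Union>U \<Longrightarrow> m \<le> card (link U v)"
  shows "m * card (\<Union>U) \<le> k * card U"
  using sum_bounded_below[of "\<Union>U" m "\<lambda>v. card (link U v)"] m sum_card_link[OF U]
  by (simp add: mult.commute)

lemma link_nonempty: "v \<in> \<Union>U \<Longrightarrow> link U v \<noteq> {}"
  using bij_betw_link[of v U] by (force simp: bij_betw_def)

section \<open>Simplex boundaries and joins of two of them\<close>

definition bd :: "'a set \<Rightarrow> 'a set set" where
  "bd X = (\<lambda>x. X - {x}) ` X"

text \<open>For disjoint P and Q this is the join of the simplex boundaries of P and Q.\<close>

definition bd_join :: "'a set \<Rightarrow> 'a set \<Rightarrow> 'a set set" where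
  "bd_join P Q = {T. T \<subseteq> P \<union> Q \<and> card (P - T) = 1 \<and> card (Q - T) = 1}"

lemma bd_iff:
  assumes "finite X"
  shows "T \<in> bd X \<longleftrightarrow> T \<subseteq> X \<and> Suc (card T) = card X"
proof
  assume "T \<in> bd X"
  then show "T \<subseteq> X \<and> Suc (card T) = card X"
    using assms by (auto simp: bd_def card_gt_0_iff intro!: Suc_pred)
next
  assume T: "T \<subseteq> X \<and> Suc (card T) = card X"
  then have "card (X - T) = card X - card T" using assms by (intro card_Diff_subset) (auto intro: finite_subset)
  then have "card (X - T) = 1" using T by linarith
  then obtain x where "X - T = {x}" by (auto simp: card_1_singleton_iff)
  then have "T = X - {x}" "x \<in> X" using T by auto
  then show "T \<in> bd X" by (auto simp: bd_def)
qed

lemma card_bd: "card (bd X) = card X"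
  unfolding bd_def by (rule card_image) (auto simp: inj_on_def)

lemma bd_join_image:
  assumes "P \<inter> Q = {}"
  shows "bd_join P Q = (\<lambda>(p, q). (P - {p}) \<union> (Q - {q})) ` (P \<times> Q)"
proof (intro set_eqI iffI)
  fix T assume "T \<in> bd_join P Q"
  then obtain p q where "P - T = {p}" "Q - T = {q}" "T \<subseteq> P \<union> Q"
    by (auto simp: bd_join_def card_1_singleton_iff)
  then have "T = (P - {p}) \<union> (Q - {q})" "p \<in> P" "q \<in> Q" by auto
  then show "T \<in> (\<lambda>(p, q). (P - {p}) \<union> (Q - {q})) ` (P \<times> Q)" by auto
next
  fix T assume "T \<in> (\<lambda>(p, q). (P - {p}) \<union> (Q - {q})) ` (P \<times> Q)"
  then obtain p q where "T = (P - {p}) \<union> (Q - {q})" "p \<in> P" "q \<in> Q" by auto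
  moreover from this have "P - T = {p}" "Q - T = {q}" using assms by auto
  ultimately show "T \<in> bd_join P Q" by (auto simp: bd_join_def)
qed

lemma card_bd_join:
  assumes "P \<inter> Q = {}"
  shows "card (bd_join P Q) = card P * card Q"
proof -
  have "inj_on (\<lambda>(p, q). (P - {p}) \<union> (Q - {q})) (P \<times> Q)"
  proof (rule inj_onI, clarify)
    fix p q p' q'
    assume *: "p \<in> P" "q \<in> Q" "p' \<in> P" "q' \<in> Q" "P - {p} \<union> (Q - {q}) = P - {p'} \<union> (Q - {q'})"
    have "P - {p} = P - {p'}" "Q - {q} = Q - {q'}" using * assms by auto
    then show "p = p' \<and> q = q'" using * by blast
  qed
  then show ?thesis by (simp add: bd_join_image[OF assms] card_image card_cartesian_product)
qed

text \<open>The numbers of points of \<open>P\<close> and of \<open>Q\<close> outside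
  \<open>T\<close> add up to 2, so both are 1 as soon as one is odd. The parity form is what
  \<open>fills\<close> asks for.\<close>

lemma bd_join_iff:
  assumes "P \<inter> Q = {}" "finite P" "finite Q" "card T + 2 = card P + card Q"
  shows "T \<in> bd_join P Q \<longleftrightarrow> T \<subseteq> P \<union> Q \<and> odd (card (Q - T))"
proof (cases "T \<subseteq> P \<union> Q")
  case True
  have "card (P \<union> Q - T) = card (P \<union> Q) - card T" "card T \<le> card (P \<union> Q)"
    using True assms by (auto intro!: card_Diff_subset card_mono intro: finite_subset)
  moreover have "card (P \<union> Q - T) = card (P - T) + card (Q - T)"
    unfolding Un_Diff by (rule card_Un_disjoint) (use assms in auto)
  moreover have "card (P \<union> Q) = card P + card Q" by (rule card_Un_disjoint) (use assms in auto)
  ultimately have "card (P - T) + card (Q - T) = 2" using assms(4) by linarith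
  then have "card (Q - T) = 0 \<and> card (P - T) = 2 \<or> card (Q - T) = 1 \<and> card (P - T) = 1
      \<or> card (Q - T) = 2 \<and> card (P - T) = 0" by linarith
  then show ?thesis using True by (auto simp: bd_join_def)
qed (auto simp: bd_join_def)

text \<open>Evenness at \<open>B - {x}\<close> yields a second block, which trades x for a point
  outside \<open>B\<close>. With at most k + 1 points there is only one such point, so every trade
  uses it and all facets of the simplex occur.\<close>

lemma unitrade_few_points:
  assumes U: "unitrade k U" and k: "k > 0" and ne: "U \<noteq> {}" and n: "card (\<Union>U) \<le> Suc k"
  shows "U = bd (\<Union>U) \<and> card (\<Union>U) = Suc k"
proof -
  let ?X = "\<Union>U"
  have fX: "finite ?X" by (rule unitrade_finite_Union[OF U])
  obtain B where B: "B \<in> U" using ne by blast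
  note fB = unitrade_finite_block[OF U B] and cB = unitrade_card_block[OF U B]
  have ex: "\<exists>y\<in>?X - B. insert y (B - {x}) \<in> U" if x: "x \<in> B" for x
  proof -
    let ?A = "{C\<in>U. B - {x} \<subseteq> C}"
    have "even (card ?A)" by (rule unitrade_even[OF U]) (use x fB cB in auto)
    moreover have "?A \<noteq> {B}" if "even (card ?A)" using that by auto
    moreover have "B \<in> ?A" using B by auto
    ultimately obtain C where C: "C \<in> U" "B - {x} \<subseteq> C" "C \<noteq> B" by blast
    note fC = unitrade_finite_block[OF U C(1)] and cC = unitrade_card_block[OF U C(1)]
    have "card (C - (B - {x})) = 1" using C fB cB cC x k by (simp add: card_Diff_subset)
    then obtain y where y: "C - (B - {x}) = {y}" by (auto simp: card_1_singleton_iff)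
    then have Cy: "C = insert y (B - {x})" using C(2) by auto
    moreover have "y \<notin> B" using y C(3) x Cy by auto
    ultimately show ?thesis using C(1) by auto
  qed
  have "card B > 0" using k cB by simp
  then obtain x0 where x0: "x0 \<in> B" by (auto simp: card_gt_0_iff)
  from ex[OF x0] obtain y where y: "y \<in> ?X" "y \<notin> B" by blast
  have sub: "insert y B \<subseteq> ?X" using y B by auto
  have "card (insert y B) = Suc k" using y fB cB by simp
  then have X: "?X = insert y B" using card_seteq[OF fX sub] n by simp
  then have cX: "card ?X = Suc k" using y fB cB by simp
  have "bd ?X \<subseteq> U"
  proof
    fix T assume "T \<in> bd ?X"
    then obtain x where x: "x \<in> insert y B" "T = insert y B - {x}" unfolding X bd_def by blast
    show "T \<in> U"
    proof (cases "x = y")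
      case True then show ?thesis using x y B by simp
    next
      case False
      then have "x \<in> B" using x by simp
      then obtain z where "z \<in> ?X - B" "insert z (B - {x}) \<in> U" using ex by blast
      moreover from this have "z = y" unfolding X by auto
      moreover have "T = insert y (B - {x})" using x False by auto
      ultimately show ?thesis by simp
    qed
  qed
  moreover have "U \<subseteq> bd ?X"
    using bd_iff[OF fX] cX unitrade_card_block[OF U] by auto
  ultimately show ?thesis using cX by auto
qed

lemma unitrade_bd:
  fixes X :: "'a set"
  assumes "card X = Suc k"  "k > 0"
  shows "unitrade k (bd X)"
  unfolding unitrade_iff
proof (intro conjI ballI allI impI)
  have fX: "finite X" using assms by (metis card.infinite nat.distinct(1))
  then show "finite (bd X)" by (simp add: bd_def)
  fix B assume "B \<in> bd X"
  then have B: "B \<subseteq> X \<and> Suc (card B) = card X" using bd_iff[OF fX] by simp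
  then show "finite B" "card B = k" using assms fX by (auto intro: finite_subset)
next
  fix T :: "'a set" assume T: "finite T \<and> card T = k - 1"
  have fX: "finite X" using assms by (metis card.infinite nat.distinct(1))
  show "even (card {B \<in> bd X. T \<subseteq> B})"
  proof (cases "T \<subseteq> X")
    case True
    have "{B \<in> bd X. T \<subseteq> B} = (\<lambda>x. X - {x}) ` (X - T)" using True by (auto simp: bd_def)
    moreover have "inj_on (\<lambda>x. X - {x}) (X - T)" by (auto simp: inj_on_def)
    ultimately have "card {B \<in> bd X. T \<subseteq> B} = card (X - T)" by (simp add: card_image)
    also have "\<dots> = 2" using True T assms fX by (simp add: card_Diff_subset)
    finally show ?thesis by simp
  next
    case False
    then have "{B \<in> bd X. T \<subseteq> B} = {}" by (auto simp: bd_def)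
    then show ?thesis by (simp only: card.empty even_zero)
  qed
qed

section \<open>Addition mod 2, fillings and the replacement of a star\<close>

lemma card_sym_diff:
  assumes "finite A" "finite B"
  shows "card (sym_diff A B) + 2 * card (A \<inter> B) = card A + card B"
proof -
  have "card (sym_diff A B) = card (A - B) + card (B - A)"
    by (rule card_Un_disjoint) (use assms in auto)
  moreover have "card A = card (A - B) + card (A \<inter> B)" "card B = card (B - A) + card (A \<inter> B)"
    using card_Diff_subset_Int[of A B] card_Diff_subset_Int[of B A]
      card_mono[of A "A \<inter> B"] card_mono[of B "A \<inter> B"] assms by (auto simp: Int_commute)
  ultimately show ?thesis by simp
qed

lemma unitrade_sym_diff:
  fixes A :: "'a set set"
  assumes "unitrade k A" "unitrade k B"
  shows "unitrade k (sym_diff A B)"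
  unfolding unitrade_iff
proof (intro conjI ballI allI impI)
  fix T :: "'a set" assume T: "finite T \<and> card T = k - 1"
  have "{C \<in> sym_diff A B. T \<subseteq> C} = sym_diff {C\<in>A. T \<subseteq> C} {C\<in>B. T \<subseteq> C}" by auto
  moreover have "even (card {C\<in>A. T \<subseteq> C})" "even (card {C\<in>B. T \<subseteq> C})"
    using T assms by (auto simp: unitrade_iff)
  moreover have "card (sym_diff {C\<in>A. T \<subseteq> C} {C\<in>B. T \<subseteq> C}) + 2 * card ({C\<in>A. T \<subseteq> C} \<inter> {C\<in>B. T \<subseteq> C})
      = card {C\<in>A. T \<subseteq> C} + card {C\<in>B. T \<subseteq> C}"
    by (rule card_sym_diff) (use assms in \<open>auto simp: unitrade_iff\<close>)
  ultimately show "even (card {C \<in> sym_diff A B. T \<subseteq> C})"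
    by presburger
qed (use assms in \<open>auto simp: unitrade_iff\<close>)

text \<open>The mod-2 boundary of the chain S is L, and no simplex of S contains v.\<close>

definition fills :: "nat \<Rightarrow> 'a \<Rightarrow> 'a set set \<Rightarrow> 'a set set \<Rightarrow> bool" where
  "fills k v S L \<longleftrightarrow> finite S \<and> (\<forall>B\<in>S. finite B \<and> card B = k \<and> v \<notin> B) \<and>
     (\<forall>T. finite T \<and> card T = k - 1 \<longrightarrow> (T \<in> L \<longleftrightarrow> odd (card {B\<in>S. T \<subseteq> B})))"

text \<open>The sum mod 2 of U and the boundary of the cone over S with apex v, provided S fills the link of v.\<close>

definition surgery :: "'a set set \<Rightarrow> 'a \<Rightarrow> 'a set set \<Rightarrow> 'a set set" where
  "surgery U v S = sym_diff {B\<in>U. v \<notin> B} S"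

text \<open>Only sets \<open>T\<close> without \<open>v\<close> matter. Of the removed blocks at
  most \<open>insert v T\<close> contains \<open>T\<close>, and it is present exactly when
  \<open>T\<close> lies in the link; the filling contributes the same parity.\<close>

lemma unitrade_surgery:
  fixes U :: "'a set set"
  assumes U: "unitrade k U" and k: "k > 0" and S: "fills k v S (link U v)"
  shows "unitrade k (surgery U v S)"
  unfolding unitrade_iff
proof (intro conjI ballI allI impI)
  show "finite (surgery U v S)"
    using unitrade_finite[OF U] S by (auto simp: surgery_def fills_def)
next
  fix B assume "B \<in> surgery U v S"
  then show "finite B" "card B = k"
    using U S unfolding surgery_def fills_def unitrade_iff by auto
next
  fix T :: "'a set" assume T: "finite T \<and> card T = k - 1"
  let ?A = "{B\<in>U. v \<notin> B \<and> T \<subseteq> B}" and ?S = "{B\<in>S. T \<subseteq> B}" and ?L = "{B\<in>U. v \<in> B \<and> T \<subseteq> B}"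
  have fU: "finite U" "finite S" using unitrade_finite[OF U] S by (auto simp: fills_def)
  show "even (card {B \<in> surgery U v S. T \<subseteq> B})"
  proof (cases "v \<in> T")
    case True
    then have "{B \<in> surgery U v S. T \<subseteq> B} = {}" using S by (auto simp: surgery_def fills_def)
    then show ?thesis by (simp only: card.empty even_zero)
  next
    case False
    have "{B \<in> surgery U v S. T \<subseteq> B} = sym_diff ?A ?S" by (auto simp: surgery_def)
    moreover have "card (sym_diff ?A ?S) + 2 * card (?A \<inter> ?S) = card ?A + card ?S"
      by (rule card_sym_diff) (use fU in auto)
    ultimately have "card {B \<in> surgery U v S. T \<subseteq> B} + 2 * card (?A \<inter> ?S) = card ?A + card ?S"
      by simp
    then have 1: "even (card {B \<in> surgery U v S. T \<subseteq> B}) \<longleftrightarrow> even (card ?A + card ?S)"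
      by presburger
    have "{B\<in>U. T \<subseteq> B} = ?A \<union> ?L" by auto
    moreover have "card (?A \<union> ?L) = card ?A + card ?L" by (rule card_Un_disjoint) (use fU in auto)
    ultimately have 2: "even (card ?A + card ?L)" using unitrade_even[OF U] T by metis
    have "?L \<subseteq> {insert v T}"
    proof
      fix B assume B: "B \<in> ?L"
      then have "card B = k" "finite B" using U by (auto simp: unitrade_iff)
      moreover have "card (insert v T) = k" using False T k by simp
      ultimately have "insert v T = B" using B by (intro card_seteq) auto
      then show "B \<in> {insert v T}" by simp
    qed
    then have "?L = (if T \<in> link U v then {insert v T} else {})" using False by (auto simp: link_def)
    then have "odd (card ?L) \<longleftrightarrow> T \<in> link U v" by (simp split: if_splits)
    also have "\<dots> \<longleftrightarrow> odd (card ?S)" using S T by (auto simp: fills_def)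
    finally show ?thesis using 1 2 by auto
  qed
qed

text \<open>Symmetric difference with \<open>S\<close> is an involution. The descents below recover
  \<open>U\<close> from the smaller unitrade through this equation.\<close>

lemma surgery_inverse:
  "U = insert v ` link U v \<union> sym_diff (surgery U v S) S"
  by (auto simp: insert_link surgery_def)

lemma card_surgery:
  assumes "unitrade k U" "fills k v S (link U v)"
  shows "card (surgery U v S) + card (link U v) + 2 * card (S \<inter> U) = card U + card S"
proof -
  have fU: "finite U" "finite S" using unitrade_finite[OF assms(1)] assms(2) by (auto simp: fills_def)
  have "{B\<in>U. v \<notin> B} \<inter> S = S \<inter> U" using assms(2) by (auto simp: fills_def)
  moreover have "card (surgery U v S) + 2 * card ({B\<in>U. v \<notin> B} \<inter> S) = card {B\<in>U. v \<notin> B} + card S"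
    unfolding surgery_def by (rule card_sym_diff) (use fU in auto)
  ultimately show ?thesis using card_eq_link_plus[OF fU(1), of v] by simp
qed

lemma surgery_avoids: "fills k v S L \<Longrightarrow> B \<in> surgery U v S \<Longrightarrow> v \<notin> B"
  by (auto simp: surgery_def fills_def)

lemma surgery_mem_iff: "fills k v S L \<Longrightarrow> B \<in> S \<Longrightarrow> B \<in> surgery U v S \<longleftrightarrow> B \<notin> U"
  by (auto simp: surgery_def fills_def)

text \<open>The star of \<open>v\<close> and the filling are the only places that change, so a known
  result of surgery reveals degrees in \<open>U\<close>.\<close>

lemma card_link_surgery:
  assumes "z \<notin> \<Union>S" "z \<noteq> v" "z \<notin> \<Union>(link U v)"
  shows "card (link (surgery U v S) z) = card (link U z)"
proof -
  have "v \<notin> B" if "B \<in> U" "z \<in> B" for B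
  proof
    assume "v \<in> B"
    then have "B - {v} \<in> link U v" using that by (auto simp: link_def insert_absorb)
    then show False using assms that by auto
  qed
  then have "{B \<in> surgery U v S. z \<in> B} = {B\<in>U. z \<in> B}" using assms(1) by (auto simp: surgery_def)
  then show ?thesis by (simp add: card_link)
qed

lemma fills_bd:
  assumes "card P = k" "k > 0" "v \<notin> P"
  shows "fills k v {P} (bd P)"
proof -
  have fP: "finite P" using assms by (metis card.infinite less_numeral_extra(3))
  have "T \<in> bd P \<longleftrightarrow> odd (card {B\<in>{P}. T \<subseteq> B})" if "card T = k - 1" for T
  proof -
    have "{B\<in>{P}. T \<subseteq> B} = (if T \<subseteq> P then {P} else {})" by auto
    then show ?thesis using bd_iff[OF fP, of T] that assms by (auto split: if_splits)
  qed
  then show ?thesis using assms fP by (auto simp: fills_def)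
qed

lemma fills_bd_Un_bd:
  assumes "card P = k" "card Q = k" "k > 0" "v \<notin> P" "v \<notin> Q" "bd P \<inter> bd Q = {}" "P \<noteq> Q"
  shows "fills k v {P, Q} (bd P \<union> bd Q)"
proof -
  have f: "finite P" "finite Q" using assms by (metis card.infinite less_numeral_extra(3))+
  have "T \<in> bd P \<union> bd Q \<longleftrightarrow> odd (card {B\<in>{P,Q}. T \<subseteq> B})" if "card T = k - 1" for T
  proof -
    have "{B\<in>{P,Q}. T \<subseteq> B} = (if T \<subseteq> P then {P} else {}) \<union> (if T \<subseteq> Q then {Q} else {})" by auto
    moreover have "\<not> (T \<subseteq> P \<and> T \<subseteq> Q)"
      using assms(6) bd_iff[OF f(1), of T] bd_iff[OF f(2), of T] that assms by auto
    ultimately show ?thesis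
      using bd_iff[OF f(1), of T] bd_iff[OF f(2), of T] that assms by (auto split: if_splits)
  qed
  then show ?thesis using assms f by (auto simp: fills_def)
qed

text \<open>The join of the full simplex P with the boundary of Q; it fills the join of the two boundaries.\<close>

definition cone_bd :: "'a set \<Rightarrow> 'a set \<Rightarrow> 'a set set" where
  "cone_bd P Q = (\<lambda>q. P \<union> (Q - {q})) ` Q"

lemma inj_on_cone_bd: "P \<inter> Q = {} \<Longrightarrow> inj_on (\<lambda>q. P \<union> (Q - {q})) Q"
  by (auto simp: inj_on_def)

lemma card_cone_bd: "P \<inter> Q = {} \<Longrightarrow> card (cone_bd P Q) = card Q"
  unfolding cone_bd_def by (rule card_image) (rule inj_on_cone_bd)

text \<open>For \<open>T\<close> inside \<open>P \<union> Q\<close> the simplices of the cone over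
  \<open>T\<close> correspond to the points of \<open>Q - T\<close>, so their parity is the one in
  \<open>bd_join_iff\<close>.\<close>

lemma fills_bd_join:
  assumes PQ: "P \<inter> Q = {}" "finite P" "finite Q" "card P + card Q = Suc k"
    and k: "k > 0" and v: "v \<notin> P" "v \<notin> Q"
  shows "fills k v (cone_bd P Q) (bd_join P Q)"
proof -
  have "card (P \<union> (Q - {q})) = k" if "q \<in> Q" for q
  proof -
    have "card (P \<union> (Q - {q})) = card P + card (Q - {q})" by (rule card_Un_disjoint) (use PQ in auto)
    moreover have "card Q > 0" using that PQ card_gt_0_iff by blast
    ultimately show ?thesis using that PQ by simp
  qed
  moreover have "T \<in> bd_join P Q \<longleftrightarrow> odd (card {B\<in>cone_bd P Q. T \<subseteq> B})" if T: "card T = k - 1" for T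
  proof (cases "T \<subseteq> P \<union> Q")
    case True
    have "{B\<in>cone_bd P Q. T \<subseteq> B} = (\<lambda>q. P \<union> (Q - {q})) ` (Q - T)"
      using True PQ(1) by (auto simp: cone_bd_def)
    moreover have "inj_on (\<lambda>q. P \<union> (Q - {q})) (Q - T)"
      using inj_on_cone_bd[OF PQ(1)] by (rule inj_on_subset) auto
    ultimately have "card {B\<in>cone_bd P Q. T \<subseteq> B} = card (Q - T)" by (simp add: card_image)
    then show ?thesis using bd_join_iff[OF PQ(1-3), of T] True T PQ(4) k by simp
  next
    case False
    then have "{B\<in>cone_bd P Q. T \<subseteq> B} = {}" by (auto simp: cone_bd_def)
    then have "card {B\<in>cone_bd P Q. T \<subseteq> B} = 0" by (simp only: card.empty)
    then show ?thesis using False by (simp add: bd_join_def)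
  qed
  ultimately show ?thesis using assms by (auto simp: fills_def cone_bd_def)
qed

section \<open>Unitrades of small size\<close>

lemma bd_insert: "v \<notin> P \<Longrightarrow> bd (insert v P) = insert P (insert v ` bd P)"
proof -
  assume v: "v \<notin> P"
  have "bd (insert v P) = insert (insert v P - {v}) ((\<lambda>x. insert v P - {x}) ` P)" by (simp add: bd_def)
  moreover have "(\<lambda>x. insert v P - {x}) ` P = insert v ` bd P"
    unfolding bd_def image_image by (rule image_cong) (use v in auto)
  ultimately show ?thesis using v by simp
qed

lemma Union_bd: "card X \<ge> 2 \<Longrightarrow> \<Union>(bd X) = X"
proof
  assume X: "card X \<ge> 2"
  show "X \<subseteq> \<Union>(bd X)"
  proof
    fix x assume x: "x \<in> X"
    have "X \<noteq> {x}" using X by auto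
    then obtain y where "y \<in> X" "y \<noteq> x" using x by auto
    then have "X - {y} \<in> bd X" "x \<in> X - {y}" using x by (auto simp: bd_def)
    then show "x \<in> \<Union>(bd X)" by blast
  qed
qed (auto simp: bd_def)

lemma bd_join_commute: "bd_join P Q = bd_join Q P"
  by (auto simp: bd_join_def)

lemma Union_bd_join:
  assumes "P \<inter> Q = {}" "card P \<ge> 2" "card Q \<ge> 2"
  shows "\<Union>(bd_join P Q) = P \<union> Q"
proof -
  have *: "A \<subseteq> \<Union>(bd_join A B)" if AB: "A \<inter> B = {}" "card A \<ge> 2" "card B \<ge> 2" for A B :: "'a set"
  proof
    fix x assume x: "x \<in> A"
    have "A \<noteq> {x}" "B \<noteq> {}" using AB by auto
    then obtain y z where "y \<in> A" "y \<noteq> x" "z \<in> B" using x by auto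
    then have "(A - {y}) \<union> (B - {z}) \<in> bd_join A B" "x \<in> (A - {y}) \<union> (B - {z})"
      using x AB(1) by (auto simp: bd_join_image)
    then show "x \<in> \<Union>(bd_join A B)" by blast
  qed
  have "P \<subseteq> \<Union>(bd_join P Q)" by (rule *) (use assms in auto)
  moreover have "Q \<subseteq> \<Union>(bd_join P Q)"
    unfolding bd_join_commute[of P] by (rule *) (use assms in auto)
  ultimately show ?thesis by (auto simp: bd_join_def)
qed

text \<open>The blocks are sorted by whether the point omitted from \<open>insert v P\<close> is
  \<open>v\<close>. Those that omit \<open>v\<close> form the filling, so a join splits off from
  \<open>U\<close> when the whole filling lies in \<open>U\<close>.\<close>

lemma bd_join_insert:
  assumes "P \<inter> Q = {}" "v \<notin> P" "v \<notin> Q"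
  shows "bd_join (insert v P) Q = insert v ` bd_join P Q \<union> cone_bd P Q"
proof -
  have "(\<lambda>(p, q). (insert v P - {p}) \<union> (Q - {q})) ` (insert v P \<times> Q) =
    insert v ` (\<lambda>(p, q). (P - {p}) \<union> (Q - {q})) ` (P \<times> Q) \<union> (\<lambda>q. P \<union> (Q - {q})) ` Q"
    (is "?L = ?R1 \<union> ?R2")
  proof -
    have "?L = (\<lambda>(p, q). (insert v P - {p}) \<union> (Q - {q})) ` (P \<times> Q)
        \<union> (\<lambda>(p, q). (insert v P - {p}) \<union> (Q - {q})) ` ({v} \<times> Q)" by auto
    moreover have "(\<lambda>(p, q). (insert v P - {p}) \<union> (Q - {q})) ` (P \<times> Q) = ?R1"
      unfolding image_image by (rule image_cong) (use assms in \<open>auto\<close>)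
    moreover have "(\<lambda>(p, q). (insert v P - {p}) \<union> (Q - {q})) ` ({v} \<times> Q) = ?R2"
      using assms by (auto simp: image_iff)
    ultimately show ?thesis by simp
  qed
  moreover have "insert v P \<inter> Q = {}" using assms by auto
  ultimately show ?thesis using assms(1) by (simp add: bd_join_image cone_bd_def)
qed

text \<open>A suspension of the boundary of \<open>P\<close> with apexes \<open>v\<close> and
  \<open>z\<close>, the shape of \<open>R5\<close>.\<close>

lemma bd_join_pair:
  assumes "v \<notin> P" "z \<notin> P" "v \<noteq> z"
  shows "bd_join P {v, z} = insert v ` bd P \<union> insert z ` bd P"
proof -
  have "P \<inter> {v, z} = {}" using assms by auto
  then have "bd_join P {v, z} = (\<lambda>(p, q). (P - {p}) \<union> ({v, z} - {q})) ` (P \<times> {v, z})"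
    by (rule bd_join_image)
  also have "\<dots> = (\<lambda>p. (P - {p}) \<union> {z}) ` P \<union> (\<lambda>p. (P - {p}) \<union> {v}) ` P"
    using assms(3) by (auto simp: image_iff insert_Diff_if)
  finally show ?thesis by (auto simp: bd_def image_image)
qed

text \<open>The join of the two boundaries has two fillings, one with \<open>P\<close> full and one
  with \<open>Q\<close> full. Together they make up a simplex boundary, so removing one leaves the
  other.\<close>

lemma bd_Un:
  assumes "P \<inter> Q = {}"
  shows "bd (P \<union> Q) = cone_bd P Q \<union> cone_bd Q P"
proof -
  have "(\<lambda>x. P \<union> Q - {x}) ` Q = cone_bd P Q" "(\<lambda>x. P \<union> Q - {x}) ` P = cone_bd Q P"
    unfolding cone_bd_def by (rule image_cong; use assms in auto)+
  then show ?thesis by (simp add: bd_def image_Un Un_commute)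
qed

lemma cone_bd_disjoint: "P \<inter> Q = {} \<Longrightarrow> cone_bd P Q \<inter> cone_bd Q P = {}"
  unfolding cone_bd_def by blast

lemma bd_decomp:
  assumes "T \<in> bd X"
  obtains z where "X = insert z T" "z \<notin> T"
proof -
  obtain z where "z \<in> X" "T = X - {z}" using assms by (auto simp: bd_def)
  then have "X = insert z T" "z \<notin> T" by auto
  then show thesis by (rule that)
qed

section \<open>The types of small unitrades, and descent from a vertex of low degree\<close>

definition is_bd :: "nat \<Rightarrow> 'a set set \<Rightarrow> bool" where
  "is_bd n U \<longleftrightarrow> (\<exists>X. card X = n \<and> U = bd X)"

definition is_bd_join :: "nat \<Rightarrow> nat \<Rightarrow> 'a set set \<Rightarrow> bool" where
  "is_bd_join a b U \<longleftrightarrow> (\<exists>P Q. P \<inter> Q = {} \<and> card P = a \<and> card Q = b \<and> U = bd_join P Q)"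

definition is_bd_Un_bd :: "nat \<Rightarrow> 'a set set \<Rightarrow> bool" where
  "is_bd_Un_bd n U \<longleftrightarrow> (\<exists>X Y. card X = n \<and> card Y = n \<and> bd X \<inter> bd Y = {} \<and> U = bd X \<union> bd Y)"

lemma card_is_bd: "is_bd n U \<Longrightarrow> card U = n"
  by (auto simp: is_bd_def card_bd)

lemma card_is_bd_join: "is_bd_join a b U \<Longrightarrow> card U = a * b"
  by (auto simp: is_bd_join_def card_bd_join)

lemma card_is_bd_Un_bd:
  assumes "is_bd_Un_bd n U" "n > 0"
  shows "card U = 2 * n"
proof -
  obtain X Y where XY: "card X = n" "card Y = n" "bd X \<inter> bd Y = {}" "U = bd X \<union> bd Y"
    using assms by (auto simp: is_bd_Un_bd_def)
  have "finite X" "finite Y" using XY assms(2) by (metis card.infinite less_numeral_extra(3))+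
  then have "finite (bd X)" "finite (bd Y)" by (auto simp: bd_def)
  then show ?thesis using XY by (simp add: card_Un_disjoint card_bd)
qed

text \<open>By \<open>unitrade_few_points\<close> there are at least k + 2 points, so degrees of at
  least m everywhere would give m (k + 2) \<le> k |U| by double counting.\<close>

lemma low_degree_vertex:
  assumes U: "unitrade k U" "k > 0" "U \<noteq> {}" "\<not> is_bd (Suc k) U" and m: "k * card U < m * (k + 2)"
  obtains (vertex) v where "v \<in> \<Union>U" "card (link U v) < m"
proof (rule ccontr)
  assume "\<not> thesis"
  then have "m \<le> card (link U v)" if "v \<in> \<Union>U" for v using vertex[OF that] by (meson not_le)
  then have "m * card (\<Union>U) \<le> k * card U" by (rule min_degree[OF U(1)])
  moreover have "card (\<Union>U) \<ge> k + 2"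
  proof (rule ccontr)
    assume "\<not> ?thesis"
    then have "card (\<Union>U) \<le> Suc k" by simp
    from unitrade_few_points[OF U(1-3) this] show False using U(4) by (auto simp: is_bd_def)
  qed
  then have "m * (k + 2) \<le> m * card (\<Union>U)" by (rule mult_le_mono2)
  ultimately show False using m by linarith
qed

lemma card_link_pos: "unitrade k U \<Longrightarrow> v \<in> \<Union>U \<Longrightarrow> card (link U v) > 0"
  unfolding card_link using unitrade_finite[of k U] by (auto simp: card_gt_0_iff)

text \<open>The filling is the single simplex \<open>P\<close>. If it is a block, a whole simplex
  boundary splits off; otherwise \<open>U\<close> arises from \<open>U'\<close> by replacing the
  block \<open>P\<close> with the cone over its boundary from the new point
  \<open>v\<close>.\<close>

lemma descent_bd [consumes 4, case_names block nonblock]: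
  assumes U: "unitrade k U" and P: "link U v = bd P" "card P = k" and k: "k \<ge> 2"
  obtains U' where "unitrade k U'" "\<forall>B\<in>U'. v \<notin> B" "v \<notin> P" "P \<in> U" "P \<notin> U'"
      "U = bd (insert v P) \<union> U'" "bd (insert v P) \<inter> U' = {}" "card U = card U' + k + 1"
  | U' where "unitrade k U'" "\<forall>B\<in>U'. v \<notin> B" "v \<notin> P" "P \<notin> U" "P \<in> U'"
      "U = insert v ` bd P \<union> (U' - {P})" "card U + 1 = card U' + k"
proof -
  \<comment> \<open>As \<open>P\<close> has at least two points, each of them lies in a member of
    \<open>bd P\<close>, but the members of a link avoid \<open>v\<close>.\<close>
  have v: "v \<notin> P"
  proof
    assume "v \<in> P"
    then obtain T where "T \<in> link U v" "v \<in> T" using Union_bd[of P] P k by blast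
    then show False by (simp add: link_def)
  qed
  define U' where "U' = surgery U v {P}"
  have F: "fills k v {P} (link U v)" unfolding P(1) by (rule fills_bd) (use P k v in auto)
  have U': "unitrade k U'" unfolding U'_def by (rule unitrade_surgery[OF U _ F]) (use k in auto)
  have av: "\<forall>B\<in>U'. v \<notin> B" unfolding U'_def using surgery_avoids[OF F] by blast
  have iff: "P \<in> U' \<longleftrightarrow> P \<notin> U" unfolding U'_def by (rule surgery_mem_iff[OF F]) simp
  have dec: "U = insert v ` bd P \<union> sym_diff U' {P}"
    using surgery_inverse[of U v "{P}"] unfolding U'_def P(1) .
  have c: "card U' + k + 2 * card ({P} \<inter> U) = card U + 1"
    using card_surgery[OF U F] unfolding U'_def P(1) card_bd P(2) by simp
  show thesis
  proof (cases "P \<in> U")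
    case True
    have "U = bd (insert v P) \<union> U'" using dec iff True by (auto simp: bd_insert[OF v])
    moreover have "bd (insert v P) \<inter> U' = {}" using av iff True by (auto simp: bd_insert[OF v])
    moreover have "card U = card U' + k + 1" using c True by simp
    ultimately show thesis using that(1)[OF U' av v True] iff True by blast
  next
    case False
    then have "P \<in> U'" using iff by simp
    then have "sym_diff U' {P} = U' - {P}" by auto
    moreover have "{P} \<inter> U = {}" using False by simp
    ultimately show thesis using that(2)[OF U' av v False \<open>P \<in> U'\<close>] dec c by simp
  qed
qed

text \<open>Of the two fillings the one with \<open>card Q\<close> simplices is taken; wherever it
  is applied \<open>Q\<close> is not the larger side, so no more blocks are added than by the other
  one. For t = 0 the filling is exchanged as a whole, for t = \<open>card Q\<close> a join splits
  off; values in between are left to the callers.\<close>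

lemma descent_bd_join:
  assumes U: "unitrade k U" and P: "link U v = bd_join P Q" "P \<inter> Q = {}" "card P + card Q = Suc k"
    and k: "card P \<ge> 2" "card Q \<ge> 2"
  defines "U' \<equiv> surgery U v (cone_bd P Q)" and "t \<equiv> card (cone_bd P Q \<inter> U)"
  shows "unitrade k U'" "\<forall>B\<in>U'. v \<notin> B" "v \<notin> P \<union> Q"
    "card U' + card P * card Q + 2 * t = card U + card Q" "t \<le> card Q"
    "\<forall>B\<in>cone_bd P Q. B \<in> U' \<longleftrightarrow> B \<notin> U"
    "U = insert v ` bd_join P Q \<union> sym_diff U' (cone_bd P Q)"
    "t = 0 \<Longrightarrow> cone_bd P Q \<subseteq> U' \<and> U = insert v ` bd_join P Q \<union> (U' - cone_bd P Q)"
    "t = card Q \<Longrightarrow> U = bd_join (insert v P) Q \<union> U'"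
proof -
  have fin: "finite P" "finite Q" using k by (metis card.infinite not_numeral_le_zero)+
  show v: "v \<notin> P \<union> Q"
  proof
    assume "v \<in> P \<union> Q"
    then obtain T where "T \<in> link U v" "v \<in> T" using Union_bd_join[of P Q] P k by blast
    then show False by (simp add: link_def)
  qed
  have F: "fills k v (cone_bd P Q) (link U v)"
    unfolding P(1) by (rule fills_bd_join) (use P k v fin in auto)
  show "unitrade k U'" unfolding U'_def by (rule unitrade_surgery[OF U _ F]) (use k P in auto)
  show "\<forall>B\<in>U'. v \<notin> B" unfolding U'_def using surgery_avoids[OF F] by blast
  show iff: "\<forall>B\<in>cone_bd P Q. B \<in> U' \<longleftrightarrow> B \<notin> U" unfolding U'_def using surgery_mem_iff[OF F] by blast
  show dec: "U = insert v ` bd_join P Q \<union> sym_diff U' (cone_bd P Q)"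
    using surgery_inverse[of U v "cone_bd P Q"] unfolding U'_def P(1) .
  show "card U' + card P * card Q + 2 * t = card U + card Q"
    using card_surgery[OF U F] unfolding U'_def t_def P(1) card_bd_join[OF P(2)] card_cone_bd[OF P(2)] .
  have fc: "finite (cone_bd P Q)" using fin by (simp add: cone_bd_def)
  show "t \<le> card Q" unfolding t_def card_cone_bd[OF P(2), symmetric]
    by (rule card_mono[OF fc]) auto
  show "cone_bd P Q \<subseteq> U' \<and> U = insert v ` bd_join P Q \<union> (U' - cone_bd P Q)" if "t = 0"
  proof -
    have "cone_bd P Q \<inter> U = {}" using that fc unfolding t_def by simp
    then have "cone_bd P Q \<subseteq> U'" using iff by blast
    then show ?thesis using dec by auto
  qed
  show "U = bd_join (insert v P) Q \<union> U'" if "t = card Q"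
  proof -
    have "cone_bd P Q \<inter> U = cone_bd P Q"
      by (rule card_subset_eq[OF fc]) (use that in \<open>auto simp: t_def card_cone_bd[OF P(2)]\<close>)
    then have "cone_bd P Q \<inter> U' = {}" using iff by blast
    moreover have "bd_join (insert v P) Q = insert v ` bd_join P Q \<union> cone_bd P Q"
      by (rule bd_join_insert) (use P v in auto)
    ultimately show ?thesis using dec by blast
  qed
qed

text \<open>Two simplex boundaries glued along the facet \<open>P\<close>, which then disappears,
  form a suspension of \<open>bd P\<close>. Its second apex is the point of \<open>X\<close> outside
  \<open>P\<close>.\<close>

lemma is_bd_join_of_descent:
  assumes "U' = bd X" "card X = Suc k" "P \<in> U'" "v \<notin> P" "\<forall>B\<in>U'. v \<notin> B"
    "U = insert v ` bd P \<union> (U' - {P})" "k \<ge> 2"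
  obtains z where "z \<notin> P" "z \<noteq> v" "X = insert z P" "U = bd_join P {v, z}"
proof -
  obtain z where z: "X = insert z P" "z \<notin> P" using assms by (auto elim: bd_decomp)
  have "\<Union>U' = X" unfolding assms(1) by (rule Union_bd) (use assms in simp)
  then have "z \<noteq> v" using z assms by blast
  moreover have "U = bd_join P {v, z}"
    unfolding bd_join_pair[OF assms(4) z(2) \<open>z \<noteq> v\<close>[symmetric]] assms(6) assms(1) z(1) bd_insert[OF z(2)]
    using z(2) by auto
  ultimately show thesis using that z by blast
qed

lemma unitrade_1_even: "unitrade 1 U \<Longrightarrow> even (card U)"
  using unitrade_even[of 1 U "{}"] by simp

text \<open>A 2-unitrade is a graph with even degrees, so a vertex of degree 1 is
  impossible.\<close>

lemma unitrade_2_small: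
  assumes U: "unitrade 2 U" and c: "card U \<le> 3"
  shows "U = {} \<or> is_bd 3 U"
proof (rule ccontr)
  assume "\<not> ?thesis"
  then have *: "U \<noteq> {}" "\<not> is_bd (Suc 2) U" by (auto simp: eval_nat_numeral)
  obtain v where v: "v \<in> \<Union>U" "card (link U v) < 2"
    by (rule low_degree_vertex[OF U _ *, of 2]) (use c in auto)
  moreover have "even (card (link U v))"
    by (rule unitrade_1_even, rule unitrade_link) (use U in \<open>auto simp: eval_nat_numeral\<close>)
  ultimately show False using card_link_pos[OF U v(1)] by presburger
qed

lemma unitrade_3_small:
  assumes "unitrade 3 U" and "card U \<le> 6"
  shows "U = {} \<or> is_bd 4 U \<or> is_bd_join 3 2 U"
  using assms
proof (induction "card U" arbitrary: U rule: less_induct)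
  case less
  note U = less.prems(1)
  show ?case
  proof (rule ccontr)
    assume neg: "\<not> ?case"
    then have *: "U \<noteq> {}" "\<not> is_bd (Suc 3) U" by (auto simp: eval_nat_numeral)
    obtain v where v: "v \<in> \<Union>U" "card (link U v) < 4"
      by (rule low_degree_vertex[OF U _ *, of 4]) (use less.prems in auto)
    have "unitrade 2 (link U v)" by (rule unitrade_link) (use U in \<open>auto simp: eval_nat_numeral\<close>)
    then have "is_bd 3 (link U v)" using unitrade_2_small link_nonempty[OF v(1)] v(2) by fastforce
    then obtain P where P: "link U v = bd P" "card P = 3" by (auto simp: is_bd_def)
    have "2 \<le> (3::nat)" by simp
    with U P show False
    proof (cases rule: descent_bd)
      case (block U')
      then have "U' = {} \<or> is_bd 4 U' \<or> is_bd_join 3 2 U'" using less by auto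
      \<comment> \<open>At most 6 - 4 = 2 blocks remain, fewer than any of the nonempty types
        has.\<close>
      then have "U' = {}" using block less.prems(2) card_is_bd[of 4 U'] card_is_bd_join[of 3 2 U'] by auto
      then have "U = bd (insert v P)" using block by simp
      moreover have "card (insert v P) = 4" using P block(3) by (simp add: card_ge_0_finite)
      ultimately have "is_bd 4 U" by (auto simp: is_bd_def)
      then show False using neg by simp
    next
      case (nonblock U')
      then have "U' = {} \<or> is_bd 4 U' \<or> is_bd_join 3 2 U'" using less by auto
      then have "is_bd 4 U'" using nonblock less.prems(2) card_is_bd_join[of 3 2 U'] by auto
      then obtain X where X: "U' = bd X" "card X = Suc 3" by (auto simp: is_bd_def)
      obtain z where "z \<notin> P" "z \<noteq> v" "U = bd_join P {v, z}"
        using is_bd_join_of_descent[OF X nonblock(5,3,2,6)] by auto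
      then have "is_bd_join 3 2 U" unfolding is_bd_join_def using P nonblock(3)
        by (intro exI[of _ P] exI[of _ "{v, z}"]) auto
      then show False using neg by simp
    qed
  qed
qed


lemma card_insert_Suc: "card P = Suc n \<Longrightarrow> v \<notin> P \<Longrightarrow> card (insert v P) = Suc (Suc n)"
  by (simp add: card_ge_0_finite)

text \<open>Nothing remains only if every simplex of the filling cancels, so the filling lies in
  \<open>U\<close>.\<close>

lemma descent_bd_join_empty:
  assumes U: "unitrade k U" and P: "link U v = bd_join P Q" "P \<inter> Q = {}" "card P + card Q = Suc k"
    and k: "card P \<ge> 2" "card Q \<ge> 2" and e: "surgery U v (cone_bd P Q) = {}"
  shows "U = bd_join (insert v P) Q" "v \<notin> P \<union> Q"
proof -
  note d = descent_bd_join[OF U P k]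
  have "cone_bd P Q \<inter> U = cone_bd P Q" using d(6) e by blast
  then have "card (cone_bd P Q \<inter> U) = card Q" by (simp add: card_cone_bd[OF P(2)])
  from d(9)[OF this] e show "U = bd_join (insert v P) Q" by simp
qed (rule descent_bd_join(3)[OF U P k])

lemma Union_cone_bd:
  assumes "card Q \<ge> 2"
  shows "\<Union>(cone_bd P Q) = P \<union> Q"
proof -
  have "\<Union>(cone_bd P Q) = (if Q = {} then {} else P) \<union> \<Union>(bd Q)" by (auto simp: cone_bd_def bd_def)
  then show ?thesis using Union_bd[OF assms] assms by auto
qed

text \<open>The filling covers \<open>P \<union> Q\<close>, which has as many points as
  \<open>X\<close>, so both agree. Deleting it from \<open>bd X\<close> leaves the opposite filling
  \<open>cone_bd Q P\<close>, which together with the star of \<open>v\<close> is a join with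
  \<open>v\<close> on the side of \<open>Q\<close>.\<close>

lemma descent_bd_join_bd:
  assumes U: "unitrade k U" and P: "link U v = bd_join P Q" "P \<inter> Q = {}" "card P + card Q = Suc k"
    and k: "card P \<ge> 2" "card Q \<ge> 2" and X: "surgery U v (cone_bd P Q) = bd X" "card X = Suc k"
    and t: "card (cone_bd P Q \<inter> U) = 0"
  shows "U = bd_join P (insert v Q)" "v \<notin> P \<union> Q"
proof -
  note d = descent_bd_join[OF U P k]
  show v: "v \<notin> P \<union> Q" by (rule d(3))
  have fin: "finite P" "finite Q" using k by (metis card.infinite not_numeral_le_zero)+
  have sub: "cone_bd P Q \<subseteq> bd X" and U_eq: "U = insert v ` bd_join P Q \<union> (bd X - cone_bd P Q)"
    using d(8)[OF t] X by auto
  have "P \<union> Q \<subseteq> X" using Union_mono[OF sub] Union_cone_bd[OF k(2)] by (auto simp: bd_def)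
  moreover have "card (P \<union> Q) = card X" using P X fin by (simp add: card_Un_disjoint)
  moreover have "finite X" using X(2) by (simp add: card_ge_0_finite)
  ultimately have "X = P \<union> Q" using card_subset_eq by metis
  then have "bd X - cone_bd P Q = cone_bd Q P"
    using bd_Un[OF P(2)] cone_bd_disjoint[OF P(2)] by auto
  moreover have "bd_join (insert v Q) P = insert v ` bd_join Q P \<union> cone_bd Q P"
    by (rule bd_join_insert) (use P(2) v in auto)
  ultimately show "U = bd_join P (insert v Q)"
    using U_eq by (simp add: bd_join_commute[of P])
qed

lemma unitrade_4_small:
  fixes U :: "'a set set"
  assumes "unitrade 4 U" and "card U \<le> 10"
  shows "U = {} \<or> is_bd 5 U \<or> is_bd_join 4 2 U \<or> is_bd_join 3 3 U \<or> is_bd_Un_bd 5 U"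
  using assms
proof (induction "card U" arbitrary: U rule: less_induct)
  case less
  note U = less.prems(1)
  show ?case
  proof (rule ccontr)
    assume neg: "\<not> ?case"
    then have *: "U \<noteq> {}" "\<not> is_bd (Suc 4) U" by (auto simp: eval_nat_numeral)
    \<comment> \<open>The descents below lose at least 3 blocks, so at most 7 remain; the next size
      above 5 is 8.\<close>
    have IH: "U' = {} \<or> is_bd 5 U'" if "unitrade 4 U'" "card U' < card U" "card U' \<le> 7" for U' :: "'a set set"
      using less.hyps[OF that(2,1)] that(3) card_is_bd_join[of 4 2 U'] card_is_bd_join[of 3 3 U']
        card_is_bd_Un_bd[of 5 U'] by auto
    obtain v where v: "v \<in> \<Union>U" "card (link U v) < 7"
      by (rule low_degree_vertex[OF U _ *, of 7]) (use less.prems in auto)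
    have "unitrade 3 (link U v)" by (rule unitrade_link) (use U in \<open>auto simp: eval_nat_numeral\<close>)
    then have "is_bd 4 (link U v) \<or> is_bd_join 3 2 (link U v)"
      using unitrade_3_small link_nonempty[OF v(1)] v(2) by fastforce
    then show False
    proof
      assume "is_bd 4 (link U v)"
      then obtain P where P: "link U v = bd P" "card P = 4" by (auto simp: is_bd_def)
      have "2 \<le> (4::nat)" by simp
      with U P show False
      proof (cases rule: descent_bd)
        case (block U')
        have c: "card (insert v P) = 5" using card_insert_Suc[of P 3 v] P block(3) by simp
        have "U' = {} \<or> is_bd 5 U'" using IH[OF block(1)] block(8) less.prems(2) by simp
        then have "is_bd 5 U \<or> is_bd_Un_bd 5 U"
          using block(6,7) c by (auto simp: is_bd_def is_bd_Un_bd_def)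
        then show False using neg by simp
      next
        case (nonblock U')
        have "U' = {} \<or> is_bd 5 U'" using IH[OF nonblock(1)] nonblock(7) less.prems(2) by simp
        then obtain X where X: "U' = bd X" "card X = Suc 4" using nonblock(5) by (auto simp: is_bd_def)
        obtain z where "z \<notin> P" "z \<noteq> v" "U = bd_join P {v, z}"
          using is_bd_join_of_descent[OF X nonblock(5,3,2,6)] by auto
        then have "is_bd_join 4 2 U" unfolding is_bd_join_def using P nonblock(3)
          by (intro exI[of _ P] exI[of _ "{v, z}"]) auto
        then show False using neg by simp
      qed
    next
      assume "is_bd_join 3 2 (link U v)"
      then obtain P Q where P: "link U v = bd_join P Q" "P \<inter> Q = {}" and c: "card P = 3" "card Q = 2"
        by (auto simp: is_bd_join_def)
      have s: "card P + card Q = Suc 4" "card P \<ge> 2" "card Q \<ge> 2" using c by auto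
      note d = descent_bd_join[OF U P s]
      let ?U = "surgery U v (cone_bd P Q)"
      have "?U = {} \<or> is_bd 5 ?U" by (rule IH[OF d(1)]) (use d(4) c less.prems(2) in auto)
      then show False
      proof
        assume "?U = {}"
        note e = descent_bd_join_empty[OF U P s this]
        have "is_bd_join 4 2 U" unfolding is_bd_join_def
          using e P(2) c card_insert_Suc[of P 2 v] by (intro exI[of _ "insert v P"] exI[of _ Q]) auto
        then show False using neg by simp
      next
        assume "is_bd 5 ?U"
        then obtain X where X: "?U = bd X" "card X = Suc 4" by (auto simp: is_bd_def)
        \<comment> \<open>Five blocks after surgery mean |U| = 9 + 2t, so the bound 10 forces t =
          0.\<close>
        have "card (cone_bd P Q \<inter> U) = 0" using d(4) c less.prems(2) X by (simp add: card_bd)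
        note e = descent_bd_join_bd[OF U P s X this]
        have "is_bd_join 3 3 U" unfolding is_bd_join_def
          using e P(2) c card_insert_Suc[of Q 1 v] by (intro exI[of _ P] exI[of _ "insert v Q"]) auto
        then show False using neg by simp
      qed
    qed
  qed
qed

lemma unitrade_5_small:
  fixes U :: "'a set set"
  assumes "unitrade 5 U" and "card U \<le> 12"
  shows "U = {} \<or> is_bd 6 U \<or> is_bd_join 5 2 U \<or> is_bd_join 4 3 U \<or> is_bd_Un_bd 6 U"
  using assms
proof (induction "card U" arbitrary: U rule: less_induct)
  case less
  note U = less.prems(1)
  show ?case
  proof (rule ccontr)
    assume neg: "\<not> ?case"
    then have *: "U \<noteq> {}" "\<not> is_bd (Suc 5) U" by (auto simp: eval_nat_numeral)
    \<comment> \<open>The descents below lose at least 4 blocks, so at most 8 remain; the next size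
      above 6 is 10.\<close>
    have IH: "U' = {} \<or> is_bd 6 U'" if "unitrade 5 U'" "card U' < card U" "card U' \<le> 8" for U' :: "'a set set"
      using less.hyps[OF that(2,1)] that(3) card_is_bd_join[of 5 2 U'] card_is_bd_join[of 4 3 U']
        card_is_bd_Un_bd[of 6 U'] less.prems(2) that(2) by auto
    \<comment> \<open>The constant 9 is the least m with 5 * 12 < 7 m. It also keeps the link types
      of sizes 9 and 10 out of the case analysis.\<close>
    obtain v where v: "v \<in> \<Union>U" "card (link U v) < 9"
      by (rule low_degree_vertex[OF U _ *, of 9]) (use less.prems in auto)
    have "unitrade 4 (link U v)" by (rule unitrade_link) (use U in \<open>auto simp: eval_nat_numeral\<close>)
    then have "is_bd 5 (link U v) \<or> is_bd_join 4 2 (link U v)"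
      using unitrade_4_small[of "link U v"] link_nonempty[OF v(1)] v(2)
        card_is_bd_join[of 3 3 "link U v"] card_is_bd_Un_bd[of 5 "link U v"] by auto
    then show False
    proof
      assume "is_bd 5 (link U v)"
      then obtain P where P: "link U v = bd P" "card P = 5" by (auto simp: is_bd_def)
      have "2 \<le> (5::nat)" by simp
      with U P show False
      proof (cases rule: descent_bd)
        case (block U')
        have c: "card (insert v P) = 6" using card_insert_Suc[of P 4 v] P block(3) by simp
        have "U' = {} \<or> is_bd 6 U'" using IH[OF block(1)] block(8) less.prems(2) by simp
        then have "is_bd 6 U \<or> is_bd_Un_bd 6 U"
          using block(6,7) c by (auto simp: is_bd_def is_bd_Un_bd_def)
        then show False using neg by simp
      next
        case (nonblock U')
        have "U' = {} \<or> is_bd 6 U'" using IH[OF nonblock(1)] nonblock(7) less.prems(2) by simp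
        then obtain X where X: "U' = bd X" "card X = Suc 5" using nonblock(5) by (auto simp: is_bd_def)
        obtain z where "z \<notin> P" "z \<noteq> v" "U = bd_join P {v, z}"
          using is_bd_join_of_descent[OF X nonblock(5,3,2,6)] by auto
        then have "is_bd_join 5 2 U" unfolding is_bd_join_def using P nonblock(3)
          by (intro exI[of _ P] exI[of _ "{v, z}"]) auto
        then show False using neg by simp
      qed
    next
      assume "is_bd_join 4 2 (link U v)"
      then obtain P Q where P: "link U v = bd_join P Q" "P \<inter> Q = {}" and c: "card P = 4" "card Q = 2"
        by (auto simp: is_bd_join_def)
      have s: "card P + card Q = Suc 5" "card P \<ge> 2" "card Q \<ge> 2" using c by auto
      note d = descent_bd_join[OF U P s]
      let ?U = "surgery U v (cone_bd P Q)"
      have "?U = {} \<or> is_bd 6 ?U" by (rule IH[OF d(1)]) (use d(4) c less.prems(2) in auto)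
      then show False
      proof
        assume "?U = {}"
        note e = descent_bd_join_empty[OF U P s this]
        have "is_bd_join 5 2 U" unfolding is_bd_join_def
          using e P(2) c card_insert_Suc[of P 3 v] by (intro exI[of _ "insert v P"] exI[of _ Q]) auto
        then show False using neg by simp
      next
        assume "is_bd 6 ?U"
        then obtain X where X: "?U = bd X" "card X = Suc 5" by (auto simp: is_bd_def)
        have "card (cone_bd P Q \<inter> U) = 0" using d(4) c less.prems(2) X by (simp add: card_bd)
        note e = descent_bd_join_bd[OF U P s X this]
        have "is_bd_join 4 3 U" unfolding is_bd_join_def
          using e P(2) c card_insert_Suc[of Q 1 v] by (intro exI[of _ P] exI[of _ "insert v Q"]) auto
        then show False using neg by simp
      qed
    qed
  qed
qed

section \<open>Explicit representatives\<close>

lemma bd_join_UN: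
  "P \<inter> Q = {} \<Longrightarrow> bd_join P Q = (\<Union>p\<in>P. (\<lambda>q. (P - {p}) \<union> (Q - {q})) ` Q)"
  by (auto simp: bd_join_image)

lemma W5_eq: "W5 = bd {1..6}"
  unfolding W5_def by (rule set_eqI) (simp add: bd_iff)

lemma R5_eq: "R5 = bd_join {1,2,3,4,5} {6,7}"
proof -
  have "bd_join {1,2,3,4,5} {6,7::nat} =
      (\<Union>p\<in>{1,2,3,4,5}. (\<lambda>q. ({1,2,3,4,5} - {p}) \<union> ({6,7} - {q})) ` {6,7})"
    by (rule bd_join_UN) simp
  \<comment> \<open>Ordered rewriting with \<open>insert_commute\<close> sorts points and blocks, so
    both sides reach the same normal form.\<close>
  then show ?thesis by (simp add: insert_Diff_if R5_def) (simp only: insert_commute)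
qed

text \<open>The triple join of the boundaries of \<open>{1,2,3,4}\<close>, \<open>{5,6}\<close> and
  \<open>{7,8}\<close>, seen as two cones over the join of the first two.\<close>

lemma F16_eq: "F16 = insert 7 ` bd_join {1,2,3,4} {5,6} \<union> insert 8 ` bd_join {1,2,3,4} {5,6}"
proof -
  have "bd_join {1,2,3,4} {5,6::nat} =
      (\<Union>p\<in>{1,2,3,4}. (\<lambda>q. ({1,2,3,4} - {p}) \<union> ({5,6} - {q})) ` {5,6})"
    by (rule bd_join_UN) simp
  then show ?thesis by (simp add: insert_Diff_if F16_def) (simp only: insert_commute)
qed

text \<open>A join with 12 blocks is glued to the boundary of the simplex on
  \<open>{2,3,4,6,7,8}\<close> along a common block, which disappears: 12 - 1 + 5 = 16.\<close>

lemma E16_eq: "E16 = insert 8 ` bd {2,3,4,6,7} \<union> (bd_join {1,2,3,4} {5,6,7} - {{2,3,4,6,7}})"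
proof -
  let ?A = "{{1,2,3,5,6}, {1,2,4,5,6}, {1,3,4,5,6}, {2,3,4,5,6}, {1,2,3,5,7}, {1,2,4,5,7},
    {1,3,4,5,7}, {2,3,4,5,7}, {1,2,3,6,7}, {1,2,4,6,7}, {1,3,4,6,7::nat}}"
  have "bd_join {1,2,3,4} {5,6,7::nat} =
      (\<Union>p\<in>{1,2,3,4}. (\<lambda>q. ({1,2,3,4} - {p}) \<union> ({5,6,7} - {q})) ` {5,6,7})"
    by (rule bd_join_UN) simp
  then have "bd_join {1,2,3,4} {5,6,7::nat} = insert {2,3,4,6,7} ?A"
    by (simp add: insert_Diff_if) (simp only: insert_commute)
  moreover have "{2,3,4,6,7} \<notin> ?A" by (simp add: set_eq_subset)
  moreover have "E16 = insert 8 ` bd {2,3,4,6,7} \<union> ?A"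
    by (simp add: insert_Diff_if E16_def bd_def) (simp only: insert_commute)
  ultimately show ?thesis by simp
qed

section \<open>Transport along injections and recognition of the representatives\<close>

lemma image_bd:
  assumes "inj_on f X"
  shows "(`) f ` bd X = bd (f ` X)"
proof -
  have "f ` (X - {x}) = f ` X - {f x}" if "x \<in> X" for x
    using inj_on_image_set_diff[OF assms, of X "{x}"] that by auto
  then show ?thesis by (auto simp: bd_def image_image)
qed

lemma image_bd_join:
  assumes f: "inj_on f (P \<union> Q)" and PQ: "P \<inter> Q = {}"
  shows "(`) f ` bd_join P Q = bd_join (f ` P) (f ` Q)"
proof -
  have "f ` (P - {p}) = f ` P - {f p}" if "p \<in> P" for p
    using inj_on_image_set_diff[OF f, of P "{p}"] that by auto
  moreover have "f ` (Q - {q}) = f ` Q - {f q}" if "q \<in> Q" for q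
    using inj_on_image_set_diff[OF f, of Q "{q}"] that by auto
  moreover have "f ` P \<inter> f ` Q = {}" using inj_on_image_Int[OF f, of P Q] PQ by auto
  ultimately show ?thesis
    using PQ by (simp add: bd_join_UN image_UN image_image image_Un)
qed

lemma image_insert_family: "(`) f ` insert v ` A = insert (f v) ` (`) f ` A"
  by (simp add: image_image)

lemma inj_on_fun_upd_insert:
  "inj_on f S \<Longrightarrow> v \<notin> S \<Longrightarrow> y \<notin> f ` S \<Longrightarrow> inj_on (f(v := y)) (insert v S)"
  by (auto simp: inj_on_def)

lemma image_fun_upd_insert: "v \<notin> S \<Longrightarrow> (f(v := y)) ` insert v S = insert y (f ` S)"
  by auto

lemma ex_inj_on_Un:
  assumes "finite A" "finite B" "A \<inter> B = {}" "finite C" "finite D" "C \<inter> D = {}"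
    "card A = card C" "card B = card D"
  obtains f where "inj_on f (A \<union> B)" "f ` A = C" "f ` B = D"
proof -
  obtain g h where "bij_betw g A C" "bij_betw h B D"
    using assms by (meson finite_same_card_bij)
  let ?f = "\<lambda>x. if x \<in> A then g x else h x"
  have "?f ` A = C" "?f ` B = D" "inj_on ?f (A \<union> B)"
    using \<open>bij_betw g A C\<close> \<open>bij_betw h B D\<close> bij_betw_disjoint_Un[OF \<open>bij_betw g A C\<close> \<open>bij_betw h B D\<close> assms(3,6)] assms(3)
    by (auto simp: bij_betw_def)
  then show thesis using that by blast
qed

lemma equivalentI: "inj_on f S \<Longrightarrow> \<Union>U \<subseteq> S \<Longrightarrow> (`) f ` U = V \<Longrightarrow> equivalent U V"
  unfolding equivalent_def by (auto intro: inj_on_subset)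

lemma equivalent_W5:
  assumes "card X = 6"
  shows "equivalent (bd X) W5"
proof -
  have "finite X" using assms by (simp add: card_ge_0_finite)
  then obtain f where "bij_betw f X {1..6::nat}"
    using assms finite_same_card_bij[of X "{1..6::nat}"] by auto
  then have "inj_on f X" "f ` X = {1..6}" by (auto simp: bij_betw_def)
  moreover have "\<Union>(bd X) \<subseteq> X" by (auto simp: bd_def)
  ultimately show ?thesis
    by (intro equivalentI[of f X]) (simp_all add: W5_eq image_bd)
qed

lemma equivalent_R5:
  assumes "P \<inter> Q = {}" "card P = 5" "card Q = 2"
  shows "equivalent (bd_join P Q) R5"
proof -
  have "finite P" "finite Q" using assms by (auto simp: card_ge_0_finite)
  then obtain f where f: "inj_on f (P \<union> Q)" "f ` P = {1,2,3,4,5::nat}" "f ` Q = {6,7}"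
    by (rule ex_inj_on_Un[of P Q "{1,2,3,4,5::nat}" "{6,7}"]) (use assms in auto)
  moreover have "\<Union>(bd_join P Q) \<subseteq> P \<union> Q" by (auto simp: bd_join_def)
  ultimately show ?thesis
    by (intro equivalentI[OF f(1)]) (simp_all add: R5_eq image_bd_join assms(1))
qed

lemma equivalent_F16:
  assumes "P \<inter> Q = {}" "card P = 4" "card Q = 2" "v \<notin> P \<union> Q" "w \<notin> P \<union> Q" "v \<noteq> w"
    and U: "U = insert v ` bd_join P Q \<union> insert w ` bd_join P Q"
  shows "equivalent U F16"
proof -
  have "finite P" "finite Q" using assms by (auto simp: card_ge_0_finite)
  then obtain f where f: "inj_on f (P \<union> Q)" "f ` P = {1,2,3,4::nat}" "f ` Q = {5,6}"
    by (rule ex_inj_on_Un[of P Q "{1,2,3,4::nat}" "{5,6}"]) (use assms in auto)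
  define g where "g = f(v := 7, w := 8)"
  have g: "g ` P = {1,2,3,4}" "g ` Q = {5,6}" "g v = 7" "g w = 8"
    using f assms by (auto simp: g_def)
  have "f x \<noteq> 7 \<and> f x \<noteq> 8" if "x \<in> P \<union> Q" for x
  proof -
    have "f x \<in> f ` P \<union> f ` Q" using that by blast
    then show ?thesis unfolding f by auto
  qed
  then have inj: "inj_on g (insert w (insert v (P \<union> Q)))" unfolding g_def
    by (intro inj_on_fun_upd_insert) (use f(1) assms in auto)
  then have "inj_on g (P \<union> Q)" by (rule inj_on_subset) auto
  then have "(`) g ` U = F16"
    unfolding U F16_eq image_Un image_insert_family by (simp add: image_bd_join assms(1) g)
  then show ?thesis
    by (intro equivalentI[OF inj]) (auto simp: U bd_join_def)
qed

text \<open>Any block of the join may be the deleted one, since the bijections can be built around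
  it: \<open>P\<close> misses one point of each side, and these go to 1 and 5, the points that
  \<open>{2,3,4,6,7}\<close> misses.\<close>

lemma equivalent_E16:
  assumes AB: "A \<inter> B = {}" "card A = 4" "card B = 3" and P: "P \<in> bd_join A B" and v: "v \<notin> A \<union> B"
    and U: "U = insert v ` bd P \<union> (bd_join A B - {P})"
  shows "equivalent U E16"
proof -
  obtain a b where ab: "a \<in> A" "b \<in> B" and P_eq: "P = (A - {a}) \<union> (B - {b})"
    using P by (auto simp: bd_join_image[OF AB(1)])
  have fin: "finite A" "finite B" using AB by (auto simp: card_ge_0_finite)
  obtain f where f: "inj_on f ((A - {a}) \<union> (B - {b}))" "f ` (A - {a}) = {2,3,4::nat}" "f ` (B - {b}) = {6,7}"
    by (rule ex_inj_on_Un[of "A - {a}" "B - {b}" "{2,3,4::nat}" "{6,7}"]) (use AB fin ab in auto)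
  define g where "g = f(a := 1, b := 5, v := 8)"
  have "g ` (A - {a}) = f ` (A - {a})" "g ` (B - {b}) = f ` (B - {b})"
    unfolding g_def by (rule image_cong; use AB v ab in auto)+
  then have g': "g ` (A - {a}) = {2,3,4}" "g ` (B - {b}) = {6,7}" "g a = 1" "g b = 5" "g v = 8"
    using f AB(1) v ab by (auto simp: g_def)
  have "g ` A = insert (g a) (g ` (A - {a}))" "g ` B = insert (g b) (g ` (B - {b}))" using ab by auto
  then have g: "g ` A = {1,2,3,4}" "g ` B = {5,6,7}" "g ` P = {2,3,4,6,7}"
    unfolding P_eq image_Un g' by auto
  let ?S = "A - {a} \<union> (B - {b})"
  have fS: "f ` ?S = {2,3,4,6,7}" unfolding image_Un f by auto
  have inj1: "inj_on (f(a := 1)) (insert a ?S)"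
    by (rule inj_on_fun_upd_insert[OF f(1)]) (use AB(1) ab in \<open>auto simp: fS\<close>)
  have f1: "(f(a := 1)) ` insert a ?S = {1,2,3,4,6,7}"
    by (subst image_fun_upd_insert) (use AB(1) ab fS in auto)
  have inj2: "inj_on (f(a := 1, b := 5)) (insert b (insert a ?S))"
    by (rule inj_on_fun_upd_insert[OF inj1], use AB(1) ab in blast) (unfold f1, simp)
  have f2: "(f(a := 1, b := 5)) ` insert b (insert a ?S) = {5,1,2,3,4,6,7}"
    by (subst image_fun_upd_insert, use AB(1) ab in blast) (simp only: f1)
  have "inj_on g (insert v (insert b (insert a ?S)))" unfolding g_def
    by (rule inj_on_fun_upd_insert[OF inj2], use v ab in blast) (unfold f2, simp)
  moreover have "insert v (insert b (insert a (A - {a} \<union> (B - {b})))) = insert v (A \<union> B)" using ab by auto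
  ultimately have inj: "inj_on g (insert v (A \<union> B))" by simp
  have injs: "inj_on g (A \<union> B)" "inj_on g P" by (rule inj_on_subset[OF inj]; auto simp: P_eq)+
  have "inj_on ((`) g) (bd_join A B)"
    by (rule inj_on_image, rule inj_on_subset[OF inj]) (auto simp: bd_join_def)
  then have "(`) g ` (bd_join A B - {P}) = (`) g ` bd_join A B - (`) g ` {P}"
    by (rule inj_on_image_set_diff) (use P in auto)
  then have "(`) g ` U = E16"
    unfolding U E16_eq image_Un image_insert_family
    by (simp add: image_bd_join AB(1) g g' image_bd injs)
  moreover have "T \<subseteq> A \<union> B" if "T \<in> bd P \<or> T \<in> bd_join A B" for T
    using that by (auto simp: bd_def bd_join_def P_eq)
  then have "\<Union>U \<subseteq> insert v (A \<union> B)" unfolding U by blast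
  ultimately show ?thesis by (intro equivalentI[OF inj])
qed

text \<open>The suspension is the sum mod 2 of the boundaries of \<open>insert v P\<close> and
  \<open>insert z P\<close>, whose common facet \<open>P\<close> cancels.\<close>

lemma unitrade_bd_join_pair:
  assumes "v \<notin> P" "z \<notin> P" "v \<noteq> z" "card P = k" "k > 0"
  shows "unitrade k (bd_join P {v, z})"
proof -
  have "finite P" using assms by (metis card.infinite less_numeral_extra(3))
  then have "unitrade k (sym_diff (bd (insert v P)) (bd (insert z P)))"
    by (intro unitrade_sym_diff unitrade_bd) (use assms in auto)
  moreover have "z \<notin> T \<and> v \<notin> T" if "T \<in> bd P" for T using that assms by (auto simp: bd_def)
  then have "insert v ` bd P \<inter> insert z ` bd P = {}" using assms(3) by auto
  then have "sym_diff (bd (insert v P)) (bd (insert z P)) = bd_join P {v, z}"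
    unfolding bd_insert[OF assms(1)] bd_insert[OF assms(2)] bd_join_pair[OF assms(1-3)]
    using assms(1,2) by auto
  ultimately show ?thesis by simp
qed

text \<open>Disjointness comes from counting: 6 + 10 = 16 leaves no room for a common block.\<close>

lemma kind_WR_I:
  assumes "card U = 16" "U = bd X \<union> bd_join P Q" "card X = 6" "P \<inter> Q = {}" "card P = 5" "card Q = 2"
  shows "kind_WR U"
proof -
  have W: "unitrade 5 (bd X)" by (rule unitrade_bd) (use assms in auto)
  obtain y z where Q: "Q = {y, z}" "y \<noteq> z" using assms(6) by (auto simp: card_2_iff)
  have R: "unitrade 5 (bd_join P Q)"
    unfolding Q by (rule unitrade_bd_join_pair) (use assms Q in auto)
  have "card (bd X) + card (bd_join P Q) = card U + card (bd X \<inter> bd_join P Q)"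
    unfolding assms(2) by (rule card_Un_Int) (use W R unitrade_finite in blast)+
  then have "card (bd X \<inter> bd_join P Q) = 0" using assms by (simp add: card_bd card_bd_join)
  then have "bd X \<inter> bd_join P Q = {}" using unitrade_finite[OF W] by simp
  then show ?thesis
    unfolding kind_WR_def using W R equivalent_W5[OF assms(3)] equivalent_R5[OF assms(4-6)] assms(2) by blast
qed

section \<open>The three kinds exclude each other\<close>

lemma equivalent_sym:
  assumes "equivalent U V"
  shows "equivalent V U"
proof -
  obtain f where f: "inj_on f (\<Union>U)" and V: "V = (`) f ` U" using assms by (auto simp: equivalent_def)
  let ?g = "inv_into (\<Union>U) f"
  have UV: "\<Union>V = f ` \<Union>U" unfolding V by auto
  have "inj_on ?g (\<Union>V)" unfolding UV by (rule inj_on_inv_into) simp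
  moreover have "(`) ?g ` V = U"
  proof -
    have "?g ` f ` B = B" if "B \<in> U" for B
      using f by (rule inv_into_image_cancel) (use that in blast)
    then show ?thesis unfolding V by (force simp: image_image)
  qed
  ultimately show ?thesis unfolding equivalent_def by metis
qed

lemma equivalent_trans:
  assumes "equivalent U V" "equivalent V W"
  shows "equivalent U W"
proof -
  obtain f g where f: "inj_on f (\<Union>U)" and V: "V = (`) f ` U" and g: "inj_on g (\<Union>V)" and W: "W = (`) g ` V"
    using assms unfolding equivalent_def by blast
  have "\<Union>V = f ` \<Union>U" unfolding V by auto
  then have "inj_on (g \<circ> f) (\<Union>U)" using f g by (simp add: comp_inj_on)
  moreover have "W = (`) (g \<circ> f) ` U" unfolding W V by (simp add: image_comp image_image)
  ultimately show ?thesis unfolding equivalent_def by blast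
qed

text \<open>The part equivalent to \<open>W5\<close> covers six points, hence is a full simplex
  boundary by \<open>unitrade_few_points\<close>, and an injection carries it to another one. This
  invariant sets the first kind apart.\<close>

lemma kind_WR_contains_bd:
  assumes "kind_WR U" "equivalent U V"
  obtains X where "card X = 6" "bd X \<subseteq> V"
proof -
  obtain W where W: "W \<subseteq> U" "unitrade 5 W" "equivalent W W5" using assms(1) by (auto simp: kind_WR_def)
  obtain g where g: "inj_on g (\<Union>W)" "W5 = (`) g ` W" using W(3) by (auto simp: equivalent_def)
  have "\<Union>W5 = {1..6}" unfolding W5_eq by (rule Union_bd) simp
  moreover have "\<Union>((`) g ` W) = g ` \<Union>W" by auto
  then have "\<Union>W5 = g ` \<Union>W" by (simp only: g(2))
  ultimately have "card (\<Union>W) = 6" using card_image[OF g(1)] by simp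
  moreover from this have "W \<noteq> {}" by auto
  ultimately have WX: "W = bd (\<Union>W)" using unitrade_few_points[OF W(2)] by auto
  obtain f where f: "inj_on f (\<Union>U)" "V = (`) f ` U" using assms(2) by (auto simp: equivalent_def)
  have inj: "inj_on f (\<Union>W)" using f(1) by (rule inj_on_subset) (use W in blast)
  have "bd (f ` \<Union>W) = (`) f ` bd (\<Union>W)" using image_bd[OF inj] by simp
  also have "\<dots> = (`) f ` W" using WX by simp
  finally have "bd (f ` \<Union>W) \<subseteq> V" using W(1) f(2) by auto
  moreover have "card (f ` \<Union>W) = 6" using card_image[OF inj] \<open>card (\<Union>W) = 6\<close> by simp
  ultimately show thesis using that by blast
qed

text \<open>Deleting a point of \<open>A\<close> lowers the intersection by one and deleting a point
  outside \<open>A\<close> does not, so \<open>X\<close> cannot contain points of both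
  sorts.\<close>

lemma bd_constant_intersection:
  assumes X: "finite X" and c: "\<And>x. x \<in> X \<Longrightarrow> card ((X - {x}) \<inter> A) = c"
  shows "X \<inter> A = {} \<or> X \<subseteq> A"
proof (rule ccontr)
  assume "\<not> ?thesis"
  then obtain x y where xy: "x \<in> X" "x \<in> A" "y \<in> X" "y \<notin> A" by auto
  have "(X - {x}) \<inter> A = X \<inter> A - {x}" "(X - {y}) \<inter> A = X \<inter> A" using xy by auto
  moreover have "card (X \<inter> A - {x}) < card (X \<inter> A)" by (rule card_Diff1_less) (use X xy in auto)
  ultimately show False using c[OF xy(1)] c[OF xy(3)] by simp
qed

lemma bd_join_inter:
  assumes "T \<in> bd_join P Q" "finite P"
  shows "Suc (card (T \<inter> P)) = card P"
proof -
  have "card P = card (P - T) + card (P \<inter> T)" using assms(2)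
    by (metis card_Diff_subset_Int card_mono finite_Int inf_le1 le_add_diff_inverse2)
  then show ?thesis using assms(1) by (auto simp: bd_join_def Int_commute)
qed

lemma F16_inter: "B \<in> F16 \<Longrightarrow> card (B \<inter> {1,2,3,4}) = 3"
  unfolding F16_eq using bd_join_inter[of _ "{1,2,3,4::nat}" "{5,6}"] by auto

lemma not_bd_subset_F16: "card X = 6 \<Longrightarrow> \<not> bd X \<subseteq> F16"
proof
  assume X: "card X = 6" "bd X \<subseteq> F16"
  have fX: "finite X" using X by (simp add: card_ge_0_finite)
  have c: "card ((X - {x}) \<inter> {1,2,3,4}) = 3" if "x \<in> X" for x
    by (rule F16_inter) (use X that in \<open>auto simp: bd_def\<close>)
  have "X \<noteq> {}" using X by auto
  then have "X \<inter> {1,2,3,4} \<noteq> {}" using c by fastforce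
  moreover have "\<not> X \<subseteq> {1,2,3,4}" using card_mono[of "{1,2,3,4}" X] X by auto
  ultimately show False using bd_constant_intersection[OF fX c] by blast
qed

text \<open>Without 8, all facets of \<open>X\<close> are blocks of the join and meet
  \<open>{1,2,3,4}\<close> in three points. With 8, the facets through 8 come from the glued
  simplex, so \<open>X\<close> is its vertex set; but its facet opposite to 8 is the block lost in
  the gluing.\<close>

lemma not_bd_subset_E16: "card X = 6 \<Longrightarrow> \<not> bd X \<subseteq> E16"
proof
  assume X: "card X = 6" "bd X \<subseteq> E16"
  have fX: "finite X" using X by (simp add: card_ge_0_finite)
  have block: "X - {x} \<in> E16" if "x \<in> X" for x using that X by (auto simp: bd_def)
  show False
  proof (cases "8 \<in> X")
    case False
    have c: "card ((X - {x}) \<inter> {1,2,3,4}) = 3" if "x \<in> X" for x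
    proof -
      have "X - {x} \<in> bd_join {1,2,3,4} {5,6,7}" using block[OF that] False by (auto simp: E16_eq)
      then show ?thesis using bd_join_inter[of "X - {x}" "{1,2,3,4}"] by simp
    qed
    have "X \<noteq> {}" using X by auto
    then have "X \<inter> {1,2,3,4} \<noteq> {}" using c by fastforce
    moreover have "\<not> X \<subseteq> {1,2,3,4}" using card_mono[of "{1,2,3,4}" X] X by auto
    ultimately show False using bd_constant_intersection[OF fX c] by blast
  next
    case True
    have sub: "X - {x} \<subseteq> {2,3,4,6,7,8}" if "x \<in> X" "x \<noteq> 8" for x
    proof -
      have "X - {x} \<notin> bd_join {1,2,3,4} {5,6,7}" using True that by (auto simp: bd_join_def)
      then show ?thesis using block[OF that(1)] by (auto simp: E16_eq bd_def)
    qed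
    have "X \<subseteq> {2,3,4,6,7,8}"
    proof
      fix y assume y: "y \<in> X"
      \<comment> \<open>A point x other than 8 and y is needed so that the facet
        \<open>X - {x}\<close> contains both.\<close>
      have "card (X - {8, y}) > 0" using X fX True y by (simp add: card_Diff_subset card_insert_if)
      then have "X - {8, y} \<noteq> {}" by (metis card.empty less_numeral_extra(3))
      then obtain x where "x \<in> X" "x \<noteq> 8" "x \<noteq> y" by blast
      then show "y \<in> {2,3,4,6,7,8}" using sub y by blast
    qed
    then have "X = {2,3,4,6,7,8}" by (intro card_seteq) (use X in auto)
    then have "X - {8} = {2,3,4,6,7}" by auto
    then have "{2,3,4,6,7} \<in> E16" using block[OF True] by simp
    then obtain T where "{2,3,4,6,7::nat} = insert 8 T" unfolding E16_eq by blast
    then have "8 \<in> {2,3,4,6,7::nat}" by simp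
    then show False by simp
  qed
qed

text \<open>The blocks of \<open>E16\<close> through 8 form a cone over the boundary of a 5-set. As
  blocks of \<open>F16\<close> meet \<open>{1,2,3,4}\<close> in three points, the facets of the
  image of that 5-set would meet it in a constant number, at least 2. Then the image is disjoint
  from \<open>{1,2,3,4}\<close> or inside it, and neither is possible.\<close>

lemma not_equivalent_E16_F16: "\<not> equivalent E16 F16"
proof
  assume "equivalent E16 F16"
  then obtain f where f: "inj_on f (\<Union>E16)" "F16 = (`) f ` E16" by (auto simp: equivalent_def)
  let ?P = "{2,3,4,6,7::nat}"
  have "insert 8 ?P \<subseteq> \<Union>E16" by (auto simp: E16_eq bd_def)
  with f(1) have inj: "inj_on f (insert 8 ?P)" by (rule inj_on_subset)
  then have c5: "card (f ` ?P) = 5" by (simp add: inj_on_insert card_image)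
  have c: "card ((f ` ?P - {y}) \<inter> {1,2,3,4}) = 3 - card ({f 8} \<inter> {1,2,3,4})" if "y \<in> f ` ?P" for y
  proof -
    obtain x where x: "x \<in> ?P" "y = f x" using \<open>y \<in> f ` ?P\<close> by blast
    have "insert 8 (?P - {x}) \<in> E16" using x by (auto simp: E16_eq bd_def)
    then have "f ` insert 8 (?P - {x}) \<in> F16" unfolding f(2) by (rule imageI)
    moreover have "f ` (?P - {x}) = f ` ?P - {y}"
      using inj_on_image_set_diff[OF inj, of ?P "{x}"] x by auto
    ultimately have "insert (f 8) (f ` ?P - {y}) \<in> F16" by simp
    then have "card (insert (f 8) (f ` ?P - {y}) \<inter> {1,2,3,4}) = 3" by (rule F16_inter)
    moreover have "f 8 \<notin> f ` ?P" using inj by (auto simp: inj_on_def)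
    ultimately show ?thesis by (auto simp: Int_insert_left)
  qed
  define Y where "Y = f ` ?P"
  have "card {1,2,3,4::nat} = 4" by simp
  moreover have "card Y = 5" using c5 by (simp only: Y_def)
  ultimately have "\<not> Y \<subseteq> {1,2,3,4}" using card_mono[of "{1,2,3,4}" Y] by fastforce
  moreover have "finite Y" by (simp add: Y_def)
  ultimately have dis: "Y \<inter> {1,2,3,4} = {}"
    using bd_constant_intersection[of Y "{1,2,3,4}"] c unfolding Y_def[symmetric] by blast
  have "f 2 \<in> Y" by (simp add: Y_def)
  moreover have "(Y - {f 2}) \<inter> {1,2,3,4} = {}" using dis by blast
  ultimately have "3 - card ({f 8} \<inter> {1,2,3,4}) = 0"
    using c[of "f 2"] unfolding Y_def[symmetric] by (simp only: card.empty)
  moreover have "card ({f 8} \<inter> {1,2,3,4}) \<le> 1"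
    using card_mono[of "{f 8}" "{f 8} \<inter> {1,2,3,4}"] by simp
  ultimately show False by linarith
qed

section \<open>Unitrades of size 16\<close>

lemma link_insert_Un:
  assumes "\<And>T. T \<in> A \<Longrightarrow> z \<notin> T" "\<And>T. T \<in> B \<Longrightarrow> z \<notin> T"
  shows "link (insert z ` A \<union> B) z = A"
proof (intro set_eqI iffI)
  fix T assume "T \<in> link (insert z ` A \<union> B) z"
  then have T: "z \<notin> T" "insert z T \<in> insert z ` A \<union> B" by (auto simp: link_def)
  then obtain T' where "T' \<in> A" "insert z T = insert z T'" using assms(2)[of "insert z T"] by blast
  then show "T \<in> A" using T(1) assms(1)[of T'] insert_ident[of z T T'] by simp
qed (use assms(1) in \<open>auto simp: link_def\<close>)

lemma link_bd_insert: "z \<notin> P \<Longrightarrow> link (bd (insert z P)) z = bd P"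
proof -
  assume z: "z \<notin> P"
  have "link (insert z ` bd P \<union> {P}) z = bd P"
    by (rule link_insert_Un) (use z in \<open>auto simp: bd_def\<close>)
  then show ?thesis by (simp add: bd_insert[OF z])
qed

lemma link_bd_join_insert:
  assumes "P \<inter> Q = {}" "z \<notin> P" "z \<notin> Q"
  shows "link (bd_join (insert z P) Q) z = bd_join P Q"
  unfolding bd_join_insert[OF assms]
  by (rule link_insert_Un) (use assms in \<open>auto simp: bd_join_def cone_bd_def\<close>)

lemma card_link_bd:
  assumes "z \<in> X"
  shows "card (link (bd X) z) = card X - 1"
proof -
  have "X = insert z (X - {z})" using assms by auto
  then show ?thesis using link_bd_insert[of z "X - {z}"] assms by (simp add: card_bd)
qed

text \<open>In the type with sides of sizes 5 and 2 this gives degree 8 on the large side and, with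
  the sides exchanged, 5 on the small one.\<close>

lemma card_link_bd_join:
  assumes "P \<inter> Q = {}" "z \<in> P"
  shows "card (link (bd_join P Q) z) = (card P - 1) * card Q"
proof -
  have "P = insert z (P - {z})" "(P - {z}) \<inter> Q = {}" "z \<notin> Q" using assms by auto
  then show ?thesis using link_bd_join_insert[of "P - {z}" Q z] assms by (simp add: card_bd_join)
qed

section \<open>Classification by the degree of a vertex\<close>

definition classified :: "'a set set \<Rightarrow> bool" where
  "classified U \<longleftrightarrow> kind_WR U \<or> equivalent U E16 \<or> equivalent U F16"

text \<open>Up to 12 blocks only the sizes 0, 6, 10 and 12 occur. The two gaps singled out are the
  ones that surgery on 16 blocks runs into.\<close>

lemma unitrade_5_card_ne: "unitrade 5 U \<Longrightarrow> card U \<noteq> 4 \<and> card U \<noteq> 8"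
  using unitrade_5_small[of U] card_is_bd[of 6 U] card_is_bd_join[of 5 2 U]
    card_is_bd_join[of 4 3 U] card_is_bd_Un_bd[of 6 U] by auto

lemma unitrade_5_card_6: "unitrade 5 U \<Longrightarrow> card U = 6 \<Longrightarrow> \<exists>X. card X = 6 \<and> U = bd X"
  using unitrade_5_small[of U] card_is_bd_join[of 5 2 U]
    card_is_bd_join[of 4 3 U] card_is_bd_Un_bd[of 6 U] by (auto simp: is_bd_def)

lemma unitrade_5_card_10:
  "unitrade 5 U \<Longrightarrow> card U = 10 \<Longrightarrow> \<exists>P Q. P \<inter> Q = {} \<and> card P = 5 \<and> card Q = 2 \<and> U = bd_join P Q"
  using unitrade_5_small[of U] card_is_bd[of 6 U]
    card_is_bd_join[of 4 3 U] card_is_bd_Un_bd[of 6 U] by (auto simp: is_bd_join_def)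

text \<open>The exchange at the facet \<open>P\<close> of \<open>X\<close> turns \<open>bd X\<close>
  into a suspension equivalent to \<open>R5\<close> and leaves \<open>bd Y\<close> as the copy of
  \<open>W5\<close>.\<close>

lemma kind_WR_of_descent:
  assumes "card U = 16" "U = insert v ` bd P \<union> (bd X - {P}) \<union> bd Y" "card X = 6" "card Y = 6" "P \<in> bd X"
    "v \<notin> P" "\<forall>B\<in>bd X. v \<notin> B" "card P = 5"
  shows "kind_WR U"
proof -
  have "card X = Suc 5" "(5::nat) \<ge> 2" using assms by auto
  from is_bd_join_of_descent[OF refl this(1) assms(5,6,7) refl this(2)]
  obtain z where z: "z \<notin> P" "z \<noteq> v" "insert v ` bd P \<union> (bd X - {P}) = bd_join P {v, z}" by metis
  show ?thesis
    by (rule kind_WR_I[of _ Y P "{v, z}"]) (use assms z in auto)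
qed

text \<open>If \<open>P\<close> is a block, a copy of \<open>W5\<close> splits off and 10 blocks
  remain. Otherwise surgery leaves 16 - 4 = 12 blocks: a join leads to \<open>E16\<close>, and two
  simplex boundaries lead to the first kind, as \<open>P\<close> is a facet of one of them.\<close>

lemma classified_degree_5:
  assumes U: "unitrade 5 U" "card U = 16" and d: "card (link U v) = 5"
  shows "classified U"
proof -
  have "unitrade 4 (link U v)" by (rule unitrade_link) (use U in \<open>auto simp: eval_nat_numeral\<close>)
  then have "is_bd 5 (link U v)" using unitrade_4_small[of "link U v"] d
      card_is_bd_join[of 3 3 "link U v"] card_is_bd_join[of 4 2 "link U v"] card_is_bd_Un_bd[of 5 "link U v"]
    by auto
  then obtain P where P: "link U v = bd P" "card P = 5" by (auto simp: is_bd_def)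
  have "2 \<le> (5::nat)" by simp
  with U(1) P show ?thesis
  proof (cases rule: descent_bd)
    case (block U')
    then have "card U' = 10" using U by simp
    then obtain A B where AB: "A \<inter> B = {}" "card A = 5" "card B = 2" "U' = bd_join A B"
      using unitrade_5_card_10[OF block(1)] by blast
    have "card (insert v P) = 6" using card_insert_Suc[of P 4 v] P block(3) by simp
    then have "kind_WR U" using block(6) AB by (intro kind_WR_I[OF U(2)]) auto
    then show ?thesis by (simp add: classified_def)
  next
    case (nonblock U')
    then have c: "card U' = 12" using U by simp
    then have "is_bd_join 4 3 U' \<or> is_bd_Un_bd 6 U'"
      using unitrade_5_small[OF nonblock(1)] card_is_bd[of 6 U'] card_is_bd_join[of 5 2 U'] by auto
    then show ?thesis
    proof
      assume "is_bd_join 4 3 U'"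
      then obtain A B where AB: "A \<inter> B = {}" "card A = 4" "card B = 3" "U' = bd_join A B"
        by (auto simp: is_bd_join_def)
      have "\<Union>U' = A \<union> B" unfolding AB(4) by (rule Union_bd_join) (use AB in auto)
      then have "v \<notin> A \<union> B" using nonblock(2) by blast
      then have "equivalent U E16"
        using equivalent_E16[OF AB(1-3)] nonblock(5,6) AB(4) by blast
      then show ?thesis by (simp add: classified_def)
    next
      assume "is_bd_Un_bd 6 U'"
      then obtain X Y where XY: "card X = 6" "card Y = 6" "bd X \<inter> bd Y = {}" "U' = bd X \<union> bd Y"
        by (auto simp: is_bd_Un_bd_def)
      have "kind_WR U"
      proof (cases "P \<in> bd X")
        case True
        then have "U = insert v ` bd P \<union> (bd X - {P}) \<union> bd Y" using nonblock(6) XY by blast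
        then show ?thesis
          by (rule kind_WR_of_descent[OF U(2)]) (use XY True nonblock P in auto)
      next
        case False
        then have *: "P \<in> bd Y" using XY nonblock(5) by blast
        then have "U = insert v ` bd P \<union> (bd Y - {P}) \<union> bd X" using nonblock(6) XY by blast
        then show ?thesis
          by (rule kind_WR_of_descent[OF U(2)]) (use XY * nonblock P in auto)
      qed
      then show ?thesis by (simp add: classified_def)
    qed
  qed
qed

lemma card_link_outside:
  assumes "link U v = bd_join P Q" "P \<inter> Q = {}" "card P \<ge> 2" "card Q \<ge> 2" "z \<notin> P \<union> Q" "z \<noteq> v"
  shows "card (link (surgery U v (cone_bd P Q)) z) = card (link U z)"
  by (rule card_link_surgery) (use assms Union_cone_bd[of Q P] Union_bd_join[of P Q] in auto)

text \<open>Surgery leaves 10 - 2t blocks with t at most 2, and t = 1 would leave the impossible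
  size 8. For t = 2 a join splits off and a simplex boundary remains; for t = 0 either a vertex of
  degree 5 appears or \<open>Q\<close> is a side of both joins and \<open>F16\<close>
  results.\<close>

lemma classified_degree_8:
  assumes U: "unitrade 5 U" "card U = 16" and deg: "card (link U v) = 8"
  shows "classified U"
proof -
  have "unitrade 4 (link U v)" by (rule unitrade_link) (use U in \<open>auto simp: eval_nat_numeral\<close>)
  then have "is_bd_join 4 2 (link U v)" using unitrade_4_small[of "link U v"] deg
      card_is_bd_join[of 3 3 "link U v"] card_is_bd[of 5 "link U v"] card_is_bd_Un_bd[of 5 "link U v"]
    by auto
  then obtain P Q where P: "link U v = bd_join P Q" "P \<inter> Q = {}" and c: "card P = 4" "card Q = 2"
    by (auto simp: is_bd_join_def)
  have s: "card P + card Q = Suc 5" "card P \<ge> 2" "card Q \<ge> 2" using c by auto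
  note d = descent_bd_join[OF U(1) P s]
  let ?U = "surgery U v (cone_bd P Q)" and ?t = "card (cone_bd P Q \<inter> U)"
  have "card ?U + 2 * ?t = 10" "?t \<le> 2" using d(4,5) c U by auto
  then have "?t = 0 \<and> card ?U = 10 \<or> ?t = 2 \<and> card ?U = 6"
    using unitrade_5_card_ne[OF d(1)] by presburger
  then show ?thesis
  proof
    assume t: "?t = 2 \<and> card ?U = 6"
    then obtain X where X: "card X = 6" "?U = bd X" using unitrade_5_card_6[OF d(1)] by blast
    have "U = bd X \<union> bd_join (insert v P) Q" using d(9) t c X by auto
    then have "kind_WR U"
      by (rule kind_WR_I[OF U(2)]) (use X P(2) c d(3) card_insert_Suc[of P 3 v] in auto)
    then show ?thesis by (simp add: classified_def)
  next
    assume t: "?t = 0 \<and> card ?U = 10"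
    then obtain A B where AB: "A \<inter> B = {}" "card A = 5" "card B = 2" "?U = bd_join A B"
      using unitrade_5_card_10[OF d(1)] by blast
    have UAB: "\<Union>?U = A \<union> B" unfolding AB(4) by (rule Union_bd_join) (use AB in auto)
    then have v: "v \<notin> A \<union> B" using d(2) by blast
    have sub: "cone_bd P Q \<subseteq> bd_join A B" and U_eq: "U = insert v ` bd_join P Q \<union> (bd_join A B - cone_bd P Q)"
      using d(8) t AB(4) by auto
    show ?thesis
    proof (cases "B \<subseteq> P \<union> Q")
      case False
      then obtain z where z: "z \<in> B" "z \<notin> P \<union> Q" by blast
      then have "z \<noteq> v" using v by blast
      then have "card (link U z) = card (link (bd_join B A) z)"
        using card_link_outside[OF P s(2,3) z(2)] AB(4) by (simp add: bd_join_commute)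
      also have "\<dots> = 5" using card_link_bd_join[of B A z] AB z by auto
      finally show ?thesis by (rule classified_degree_5[OF U])
    next
      case True
      have fin: "finite Q" "finite A" "finite P" using c AB by (auto simp: card_ge_0_finite)
      \<comment> \<open>The block \<open>P \<union> (Q - {q})\<close> misses a point of
        \<open>B\<close>, and inside \<open>P \<union> Q\<close> the only candidate is q.\<close>
      have inB: "q \<in> B" if "q \<in> Q" for q
      proof -
        have "P \<union> (Q - {q}) \<in> bd_join A B" using sub that by (auto simp: cone_bd_def)
        then have "card (B - (P \<union> (Q - {q}))) = 1" by (simp add: bd_join_def)
        then have "B - (P \<union> (Q - {q})) \<noteq> {}" by (metis card.empty zero_neq_one)
        then show ?thesis using True by blast
      qed
      have "finite B" using AB by (simp add: card_ge_0_finite)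
      then have "Q = B" by (intro card_subset_eq) (use inB AB c in auto)
      have "Q \<noteq> {}" using c by auto
      then obtain q where "q \<in> Q" by blast
      then have "P \<union> (Q - {q}) \<in> bd_join A B" using sub by (auto simp: cone_bd_def)
      then have "P \<subseteq> A" using P(2) \<open>Q = B\<close> by (auto simp: bd_join_def)
      then have "card (A - P) = 1" using c AB fin by (simp add: card_Diff_subset)
      then obtain p where "A - P = {p}" by (auto simp: card_1_singleton_iff)
      then have p: "A = insert p P" "p \<notin> P" using \<open>P \<subseteq> A\<close> by auto
      have pQ: "p \<notin> Q" using p AB(1) \<open>Q = B\<close> by auto
      have "bd_join A B = insert p ` bd_join P Q \<union> cone_bd P Q"
        unfolding p \<open>Q = B\<close>[symmetric] by (rule bd_join_insert) (use P p pQ in auto)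
      moreover have "insert p ` bd_join P Q \<inter> cone_bd P Q = {}"
        using p(2) pQ by (auto simp: cone_bd_def)
      ultimately have "U = insert v ` bd_join P Q \<union> insert p ` bd_join P Q" using U_eq by blast
      then have "equivalent U F16"
        by (rule equivalent_F16[rotated -1]) (use P(2) c d(3) p pQ v in auto)
      then show ?thesis by (simp add: classified_def)
    qed
  qed
qed

text \<open>Again 10 - 2t blocks remain, and t = 1 and t = 3 would leave 8 and 4. The result always
  has a vertex outside \<open>P \<union> Q\<close>, which has the same degree, 5 or 8, in
  \<open>U\<close> and leads back to an earlier case.\<close>

lemma classified_degree_9:
  assumes U: "unitrade 5 U" "card U = 16" and deg: "card (link U v) = 9"
  shows "classified U"
proof -
  have "unitrade 4 (link U v)" by (rule unitrade_link) (use U in \<open>auto simp: eval_nat_numeral\<close>)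
  then have "is_bd_join 3 3 (link U v)" using unitrade_4_small[of "link U v"] deg
      card_is_bd_join[of 4 2 "link U v"] card_is_bd[of 5 "link U v"] card_is_bd_Un_bd[of 5 "link U v"]
    by auto
  then obtain P Q where P: "link U v = bd_join P Q" "P \<inter> Q = {}" and c: "card P = 3" "card Q = 3"
    by (auto simp: is_bd_join_def)
  have s: "card P + card Q = Suc 5" "card P \<ge> 2" "card Q \<ge> 2" using c by auto
  have fin: "finite P" "finite Q" using c by (auto simp: card_ge_0_finite)
  then have cPQ: "card (P \<union> Q) = 6" using c P(2) by (simp add: card_Un_disjoint)
  note d = descent_bd_join[OF U(1) P s]
  let ?U = "surgery U v (cone_bd P Q)" and ?t = "card (cone_bd P Q \<inter> U)"
  have "card ?U + 2 * ?t = 10" "?t \<le> 3" using d(4,5) c U by auto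
  then have "?t = 0 \<and> card ?U = 10 \<or> ?t = 2 \<and> card ?U = 6"
    using unitrade_5_card_ne[OF d(1)] by presburger
  then show ?thesis
  proof
    assume t: "?t = 2 \<and> card ?U = 6"
    then obtain X where X: "card X = 6" "?U = bd X" using unitrade_5_card_6[OF d(1)] by blast
    have v: "v \<notin> X" using d(2) Union_bd[of X] X by auto
    have "\<not> X \<subseteq> P \<union> Q"
    proof
      assume "X \<subseteq> P \<union> Q"
      then have "X = P \<union> Q" by (intro card_subset_eq) (use X cPQ fin in auto)
      \<comment> \<open>With vertex set \<open>P \<union> Q\<close> the result would contain the
        whole filling, contrary to t = 2.\<close>
      then have "cone_bd P Q \<subseteq> ?U" using X bd_Un[OF P(2)] by auto
      then have "cone_bd P Q \<inter> U = {}" using d(6) by blast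
      then show False using t by simp
    qed
    then obtain z where z: "z \<in> X" "z \<notin> P \<union> Q" by blast
    then have "z \<noteq> v" using v by blast
    then have "card (link U z) = 5"
      using card_link_outside[OF P s(2,3) z(2)] card_link_bd[OF z(1)] X by simp
    then show ?thesis by (rule classified_degree_5[OF U])
  next
    assume t: "?t = 0 \<and> card ?U = 10"
    then obtain A B where AB: "A \<inter> B = {}" "card A = 5" "card B = 2" "?U = bd_join A B"
      using unitrade_5_card_10[OF d(1)] by blast
    have UAB: "\<Union>?U = A \<union> B" unfolding AB(4) by (rule Union_bd_join) (use AB in auto)
    then have v: "v \<notin> A \<union> B" using d(2) by blast
    have "finite A" "finite B" using AB by (auto simp: card_ge_0_finite)
    then have "card (A \<union> B) = 7" using AB by (simp add: card_Un_disjoint)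
    then have "\<not> A \<union> B \<subseteq> P \<union> Q" using card_mono[of "P \<union> Q" "A \<union> B"] cPQ fin by auto
    then obtain z where z: "z \<in> A \<union> B" "z \<notin> P \<union> Q" by blast
    then have "z \<noteq> v" using v by blast
    then have *: "card (link U z) = card (link (bd_join A B) z)"
      using card_link_outside[OF P s(2,3) z(2)] AB(4) by simp
    show ?thesis
    proof (cases "z \<in> A")
      case True
      then have "card (link U z) = 8" using * card_link_bd_join[OF AB(1)] AB by simp
      then show ?thesis by (rule classified_degree_8[OF U])
    next
      case False
      then have "card (link U z) = 5"
        using * card_link_bd_join[of B A z] AB z by (auto simp: bd_join_commute[of A])
      then show ?thesis by (rule classified_degree_5[OF U])
    qed
  qed
qed

text \<open>The link is filled by the two simplices \<open>P\<close> and \<open>Q\<close>, and 8, 6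
  or 4 blocks remain according to how many of them belong to \<open>U\<close>. Only 6 is possible:
  the one in \<open>U\<close> splits off a simplex boundary through \<open>v\<close>, the other one
  yields a suspension.\<close>

lemma classified_degree_10:
  assumes U: "unitrade 5 U" "card U = 16" and deg: "card (link U v) = 10"
  shows "classified U"
proof -
  have "unitrade 4 (link U v)" by (rule unitrade_link) (use U in \<open>auto simp: eval_nat_numeral\<close>)
  then have "is_bd_Un_bd 5 (link U v)" using unitrade_4_small[of "link U v"] deg
      card_is_bd_join[of 4 2 "link U v"] card_is_bd_join[of 3 3 "link U v"] card_is_bd[of 5 "link U v"]
    by auto
  then obtain P Q where L: "link U v = bd P \<union> bd Q" and c: "card P = 5" "card Q = 5" and dis: "bd P \<inter> bd Q = {}"
    by (auto simp: is_bd_Un_bd_def)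
  have "P \<noteq> {}" using c by auto
  then have "P \<noteq> Q" using dis by (auto simp: bd_def)
  have "v \<notin> \<Union>(link U v)" by (auto simp: link_def)
  then have v: "v \<notin> P" "v \<notin> Q" using Union_bd[of P] Union_bd[of Q] c unfolding L by auto
  have F: "fills 5 v {P, Q} (link U v)"
    unfolding L by (rule fills_bd_Un_bd) (use c v dis \<open>P \<noteq> Q\<close> in auto)
  let ?U = "surgery U v {P, Q}"
  have U': "unitrade 5 ?U" by (rule unitrade_surgery[OF U(1) _ F]) simp
  have iff: "P \<in> ?U \<longleftrightarrow> P \<notin> U" "Q \<in> ?U \<longleftrightarrow> Q \<notin> U" by (rule surgery_mem_iff[OF F]; simp)+
  have av: "\<forall>B\<in>?U. v \<notin> B" using surgery_avoids[OF F] by blast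
  have dec: "U = insert v ` (bd P \<union> bd Q) \<union> sym_diff ?U {P, Q}"
    using surgery_inverse[of U v "{P, Q}"] unfolding L .
  have cU: "card ?U + 2 * card ({P, Q} \<inter> U) = 8"
    using card_surgery[OF U(1) F] \<open>P \<noteq> Q\<close> U(2) deg by simp
  have one: "(P \<in> U \<and> Q \<notin> U) \<or> (P \<notin> U \<and> Q \<in> U)"
    using cU unitrade_5_card_ne[OF U'] \<open>P \<noteq> Q\<close> by (auto simp: Int_insert_left split: if_splits)
  have "card ?U = 6" using one cU by (auto simp: Int_insert_left split: if_splits)
  then obtain X where X: "card X = 6" "?U = bd X" using unitrade_5_card_6[OF U'] by blast
  have "kind_WR U" using one
  proof
    assume *: "P \<in> U \<and> Q \<notin> U"
    then have "U = insert v ` bd Q \<union> (bd X - {Q}) \<union> bd (insert v P)"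
      using dec X iff by (auto simp: bd_insert[OF v(1)])
    then show ?thesis
      by (rule kind_WR_of_descent[OF U(2)]) (use X * iff c v av card_insert_Suc[of P 4 v] in auto)
  next
    assume *: "P \<notin> U \<and> Q \<in> U"
    then have "U = insert v ` bd P \<union> (bd X - {P}) \<union> bd (insert v Q)"
      using dec X iff by (auto simp: bd_insert[OF v(2)])
    then show ?thesis
      by (rule kind_WR_of_descent[OF U(2)]) (use X * iff c v av card_insert_Suc[of Q 4 v] in auto)
  qed
  then show ?thesis by (simp add: classified_def)
qed

section \<open>Upper bounds for unitrades on few points\<close>

lemma card_le_of_link:
  assumes U: "unitrade (Suc k) U" "k > 0" and n: "card (\<Union>U) \<le> Suc n"
    and L: "\<And>L :: 'a set set. unitrade k L \<Longrightarrow> card (\<Union>L) \<le> n \<Longrightarrow> card L \<le> m"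
  shows "Suc k * card (U :: 'a set set) \<le> Suc n * m"
proof -
  have fin: "finite (\<Union>U)" by (rule unitrade_finite_Union[OF U(1)])
  have "card (link U v) \<le> m" if v: "v \<in> \<Union>U" for v
  proof (rule L[OF unitrade_link[OF U]])
    have "\<Union>(link U v) \<subseteq> \<Union>U - {v}" by (auto simp: link_def)
    then have "card (\<Union>(link U v)) \<le> card (\<Union>U - {v})" using fin by (intro card_mono) auto
    then show "card (\<Union>(link U v)) \<le> n" using n v fin by simp
  qed
  then have "(\<Sum>v\<in>\<Union>U. card (link U v)) \<le> card (\<Union>U) * m"
    using sum_bounded_above[of "\<Union>U" "\<lambda>v. card (link U v)" m] by simp
  also have "\<dots> \<le> Suc n * m" using n by (rule mult_le_mono1)
  finally show ?thesis by (simp only: sum_card_link[OF U(1)])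
qed

text \<open>Links of links lead down to 1-sets on three points, where parity allows only 2 of them.
  Counting incidences upwards then bounds the sizes by 8/2, 20/3, 36/4 and 63/5, rounded down to 4,
  6, 9 and 12.\<close>

lemma unitrade_5_on_7:
  fixes U :: "'a set set"
  assumes "unitrade 5 U" "card (\<Union>U) \<le> 7"
  shows "card U \<le> 12"
proof -
  have 1: "card L \<le> 2" if L: "unitrade 1 L" "card (\<Union>L) \<le> 3" for L :: "'a set set"
  proof -
    have "L \<subseteq> (\<lambda>x. {x}) ` \<Union>L"
    proof
      fix B assume B: "B \<in> L"
      then obtain x where "B = {x}" using unitrade_card_block[OF L(1)] by (auto simp: card_1_singleton_iff)
      then show "B \<in> (\<lambda>x. {x}) ` \<Union>L" using B by blast
    qed
    then have "card L \<le> card (\<Union>L)" by (rule surj_card_le[OF unitrade_finite_Union[OF L(1)]])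
    then have "card L \<le> 3" using L(2) by simp
    then show ?thesis using unitrade_1_even[OF L(1)] by presburger
  qed
  have 2: "card L \<le> 4" if "unitrade 2 L" "card (\<Union>L) \<le> 4" for L :: "'a set set"
    using card_le_of_link[of 1 L 3 2] 1 that by (simp add: numeral_2_eq_2)
  have 3: "card L \<le> 6" if "unitrade 3 L" "card (\<Union>L) \<le> 5" for L :: "'a set set"
    using card_le_of_link[of 2 L 4 4] 2 that by simp
  have 4: "card L \<le> 9" if "unitrade 4 L" "card (\<Union>L) \<le> 6" for L :: "'a set set"
    using card_le_of_link[of 3 L 5 6] 3 that by simp
  show ?thesis using card_le_of_link[of 4 U 6 9] 4 assms by simp
qed

lemma unitrade_5_card_16_classified:
  assumes U: "unitrade 5 U" "card U = 16"
  shows "classified U"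
proof (cases "\<exists>v\<in>\<Union>U. card (link U v) \<le> 10")
  case True
  then obtain v where v: "v \<in> \<Union>U" "card (link U v) \<le> 10" by blast
  have "unitrade 4 (link U v)" by (rule unitrade_link) (use U in \<open>auto simp: eval_nat_numeral\<close>)
  then have "card (link U v) \<in> {5, 8, 9, 10}"
    using unitrade_4_small[of "link U v"] v(2) link_nonempty[OF v(1)] card_is_bd[of 5 "link U v"]
      card_is_bd_join[of 4 2 "link U v"] card_is_bd_join[of 3 3 "link U v"] card_is_bd_Un_bd[of 5 "link U v"]
    by auto
  then show ?thesis
    using classified_degree_5[OF U] classified_degree_8[OF U] classified_degree_9[OF U]
      classified_degree_10[OF U] by blast
next
  case False
  \<comment> \<open>Since 5 * 16 = 80 < 11 * 8, at most 7 points remain.\<close>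
  then have "11 * card (\<Union>U) \<le> 5 * card U" by (intro min_degree[OF U(1)]) force
  then show ?thesis using unitrade_5_on_7[OF U(1)] U(2) by simp
qed

theorem theorem1:
  fixes U :: "'a set set"
  assumes "unitrade 5 U" and "card U = 16"
  shows "(kind_WR U \<and> \<not> equivalent U E16 \<and> \<not> equivalent U F16) \<or>
         (\<not> kind_WR U \<and> equivalent U E16 \<and> \<not> equivalent U F16) \<or>
         (\<not> kind_WR U \<and> \<not> equivalent U E16 \<and> equivalent U F16)"
proof -
  have "\<not> (kind_WR U \<and> equivalent U E16)" "\<not> (kind_WR U \<and> equivalent U F16)"
    using kind_WR_contains_bd not_bd_subset_E16 not_bd_subset_F16 by metis+
  moreover have "\<not> (equivalent U E16 \<and> equivalent U F16)"
    using not_equivalent_E16_F16 equivalent_sym equivalent_trans by blast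
  ultimately show ?thesis
    using unitrade_5_card_16_classified[OF assms] by (auto simp: classified_def)
qed

end
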